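(* For all $R\in\mathrm{Sym}^2_b(\wedge^2\mathbb{R}^4)$, the algorithm described in the context (on input $R$) terminates and returns TRUE if and only if $\sec_R>0$.
   Context: Equip $\mathbb{R}^4$ with its standard inner product and $\wedge^2\mathbb{R}^4$ with the induced inner product $\langle\cdot,\cdot\rangle$ (so that $e_i\wedge e_j$, $i<j$, is an orthonormal basis). $\mathrm{Sym}^2_b(\wedge^2\mathbb{R}^4)$ is the space of symmetric endomorphisms $R$ of $\wedge^2\mathbb{R}^4$ satisfying the first Bianchi identity $\langle R(X\wedge Y),Z\wedge W\rangle+\langle R(Y\wedge Z),X\wedge W\rangle+\langle R(Z\wedge X),Y\wedge W\rangle=0$ for all $X,Y,Z,W\in\mathbb{R}^4$. $\sec_R>0$ means $\langle R(\sigma),\sigma\rangle>0$ for all $\sigma=X\wedge Y$ with $\|X\wedge Y\|=1$. The Hodge star $*$ is the symmetric endomorphism of $\wedge^2\mathbb{R}^4$ with $\langle *\alpha,\beta\rangle=\langle e_1\wedge e_2\wedge e_3\wedge e_4,\alpha\wedge\beta\rangle$. A common root-isolating partition for a finite collection of polynomials $p_i\in\mathbb{R}[x]$ is a sequence $-\infty=a_1<a_2<\dots<a_N=+\infty$ such that $p_i(a_j)\neq0$ for all $i$ and $j$, and $[a_j,a_{j+1}]$ contains exactly one root of some $p_i(x)$; if more than one $p_i(x)$ vanishes in $[a_j,a_{j+1}]$, then they must do so at the same point. Values $p(\pm\infty)$ are interpreted as limits. Such a partition is produced by combining Sturm's real root counting algorithm with Euclid's division algorithm (to compute greatest common divisors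 of polynomials). Algorithm (input $R\in\mathrm{Sym}^2_b(\wedge^2\mathbb{R}^4)$). Define $\sigma_i(x)\in\mathbb{R}[x]$, $1\leq i\leq6$, by $\det(R+x\,*-\lambda\,\mathrm{Id})=\lambda^6+\sum_{i=1}^6(-1)^i\sigma_i(x)\lambda^{6-i}$ (i.e., the $\sigma_i(x)$ are the elementary symmetric polynomials in the eigenvalues of $R+x\,*$). Let $-\infty=a_1<a_2<\dots<a_N=+\infty$ be a common root-isolating partition for $\sigma_i(x)$, $1\leq i\leq6$. If there exists $j$ such that $\sigma_i(a_j)>0$ for all $1\leq i\leq6$, return TRUE; otherwise return FALSE.
   Formalization: The partition isolates the roots of only those σ_i that are not identically zero (the final test still uses all six), and if none of these has a real root the partition is −∞<+∞; as described, no partition exists in these cases. *)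

theory Defs
  imports
    "HOL-Analysis.Analysis"
    "HOL-Computational_Algebra.Polynomial_Factorial"
    "HOL-Computational_Algebra.Field_as_Ring"
    "HOL-Library.Monad_Syntax"
begin

section \<open>Bivectors of Euclidean 4-space\<close>

text \<open>
  The library has no exterior powers.  The second exterior power of \<open>real^4\<close> is \<open>real^6\<close> with
  its standard inner product, the standard basis vectors being
  \<open>e1\<and>e2, e1\<and>e3, e1\<and>e4, e2\<and>e3, e2\<and>e4, e3\<and>e4\<close> in this order.
  Endomorphisms are matrices with respect to this orthonormal basis.
\<close>

definition wedge :: "real^4 \<Rightarrow> real^4 \<Rightarrow> real^6" where
  "wedge X Y = vector
     [X$1 * Y$2 - X$2 * Y$1, X$1 * Y$3 - X$3 * Y$1, X$1 * Y$4 - X$4 * Y$1,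
      X$2 * Y$3 - X$3 * Y$2, X$2 * Y$4 - X$4 * Y$2, X$3 * Y$4 - X$4 * Y$3]"

text \<open>\<open>vol_wedge \<alpha> \<beta>\<close> is the inner product of \<open>e1\<and>e2\<and>e3\<and>e4\<close> with \<open>\<alpha>\<and>\<beta>\<close>.\<close>

definition vol_wedge :: "real^6 \<Rightarrow> real^6 \<Rightarrow> real" where
  "vol_wedge a b = a$1 * b$6 - a$2 * b$5 + a$3 * b$4 + a$4 * b$3 - a$5 * b$2 + a$6 * b$1"

definition hodge :: "real^6^6" where
  "hodge = (\<chi> i j. vol_wedge (axis j 1) (axis i 1))"

definition Sym2b :: "(real^6^6) set" where
  "Sym2b = {R. transpose R = R \<and>
     (\<forall>X Y Z W. (R *v wedge X Y) \<bullet> wedge Z W + (R *v wedge Y Z) \<bullet> wedge X W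
                + (R *v wedge Z X) \<bullet> wedge Y W = 0)}"

definition sec_pos :: "real^6^6 \<Rightarrow> bool" where
  "sec_pos R \<longleftrightarrow> (\<forall>X Y. norm (wedge X Y) = 1 \<longrightarrow> (R *v wedge X Y) \<bullet> wedge X Y > 0)"


section \<open>Common root-isolating partitions\<close>

definition poly_at :: "real poly \<Rightarrow> ereal \<Rightarrow> ereal" where
  "poly_at p a = (case a of
       ereal r \<Rightarrow> ereal (poly p r)
     | PInfty \<Rightarrow> Lim at_top (\<lambda>x. ereal (poly p x))
     | MInfty \<Rightarrow> Lim at_bot (\<lambda>x. ereal (poly p x)))"

text \<open>
  The last disjunct covers a collection of polynomials none of which has a real root: then no
  interval can contain a root, and the partition is the trivial one.
\<close>

definition common_root_isolating_partition :: "real poly list \<Rightarrow> ereal list \<Rightarrow> bool" where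
  "common_root_isolating_partition ps as \<longleftrightarrow>
     2 \<le> length as \<and> hd as = -\<infinity> \<and> last as = \<infinity> \<and> sorted_wrt (<) as \<and>
     (\<forall>p\<in>set ps. \<forall>a\<in>set as. poly_at p a \<noteq> 0) \<and>
     ((\<forall>j. Suc j < length as \<longrightarrow>
          (\<exists>p\<in>set ps. \<exists>!x. poly p x = 0 \<and> as ! j \<le> ereal x \<and> ereal x \<le> as ! Suc j) \<and>
          (\<forall>p\<in>set ps. \<forall>q\<in>set ps. \<forall>x y.
              poly p x = 0 \<and> as ! j \<le> ereal x \<and> ereal x \<le> as ! Suc j \<and>
              poly q y = 0 \<and> as ! j \<le> ereal y \<and> ereal y \<le> as ! Suc j \<longrightarrow> x = y)) \<or>
      ((\<forall>p\<in>set ps. \<forall>x. poly p x \<noteq> 0) \<and> length as = 2))"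


section \<open>Computing such a partition by Sturm sequences and greatest common divisors\<close>

function sturm_chain :: "real poly \<Rightarrow> real poly \<Rightarrow> real poly list" where
  "sturm_chain p q = (if q = 0 then [p] else p # sturm_chain q (- (p mod q)))"
  by pat_completeness auto
termination
proof (relation "Wellfounded.measure (\<lambda>(p, q). if q = 0 then 0 else Suc (degree q))")
  fix p q :: "real poly" assume "q \<noteq> 0"
  then show "((q, - (p mod q)), p, q) \<in> Wellfounded.measure (\<lambda>(p, q). if q = 0 then 0 else Suc (degree q))"
    using degree_mod_less[of q p] by auto
qed simp

declare sturm_chain.simps [simp del]

definition sign_changes :: "real list \<Rightarrow> nat" where
  "sign_changes xs = length (remdups_adj (filter (\<lambda>s. s \<noteq> 0) (map sgn xs))) - 1"

text \<open>
  By Sturm's theorem this is the number of distinct roots of \<open>p\<close> in \<open>(a, b)\<close>, provided that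
  \<open>a < b\<close> and neither \<open>a\<close> nor \<open>b\<close> is a root.
\<close>

definition sturm_count :: "real poly \<Rightarrow> real \<Rightarrow> real \<Rightarrow> int" where
  "sturm_count p a b =
     int (sign_changes (map (\<lambda>q. poly q a) (sturm_chain p (pderiv p))))
   - int (sign_changes (map (\<lambda>q. poly q b) (sturm_chain p (pderiv p))))"

definition has_root_between :: "real poly list \<Rightarrow> real \<Rightarrow> real \<Rightarrow> bool" where
  "has_root_between ps a b \<longleftrightarrow> (\<exists>p\<in>set ps. sturm_count p a b > 0)"

text \<open>
  All members of \<open>ps\<close> taken together have at most one root in \<open>(a, b)\<close>:
  two polynomials with one root each in \<open>(a, b)\<close> vanish at the same point iff their greatest
  common divisor has a root there.
\<close>

definition isolated_between :: "real poly list \<Rightarrow> real \<Rightarrow> real \<Rightarrow> bool" where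
  "isolated_between ps a b \<longleftrightarrow>
     (\<forall>p\<in>set ps. sturm_count p a b \<le> 1) \<and>
     (\<forall>p\<in>set ps. \<forall>q\<in>set ps. sturm_count p a b = 1 \<and> sturm_count q a b = 1
        \<longrightarrow> sturm_count (gcd p q) a b = 1)"

text \<open>
  The candidates are distinct points of the middle third of \<open>(a, b)\<close>, and there are more of them
  than the polynomials in \<open>ps\<close> can have roots.
\<close>

definition splitting_point :: "real poly list \<Rightarrow> real \<Rightarrow> real \<Rightarrow> real option" where
  "splitting_point ps a b =
     find (\<lambda>m. \<forall>p\<in>set ps. poly p m \<noteq> 0)
       (map (\<lambda>k. a + (b - a) * (real k + 1) / (2 * real k + 3))
            [0..<Suc (sum_list (map degree ps))])"

text \<open>
  Bisection; the result \<open>None\<close> means that the recursion does not terminate (or that no splitting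
  point was found).  A point that has no roots on one of its sides is discarded, so that
  every interval of the resulting partition contains a root.
\<close>

partial_function (option) cut_points :: "real poly list \<Rightarrow> real \<Rightarrow> real \<Rightarrow> real list option" where
  "cut_points ps a b =
     (if isolated_between ps a b then Some []
      else do {
        m \<leftarrow> splitting_point ps a b;
        if \<not> has_root_between ps a m then cut_points ps m b
        else if \<not> has_root_between ps m b then cut_points ps a m
        else do {
          xs \<leftarrow> cut_points ps a m;
          ys \<leftarrow> cut_points ps m b;
          Some (xs @ m # ys)
        }
      })"

text \<open>By Cauchy's bound, all real roots lie strictly between \<open>- root_bound ps\<close> and \<open>root_bound ps\<close>.\<close>

definition root_bound :: "real poly list \<Rightarrow> real" where
  "root_bound ps = 1 + (\<Sum>p\<leftarrow>ps. \<Sum>i\<le>degree p. \<bar>coeff p i\<bar> / \<bar>lead_coeff p\<bar>)"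

definition sturm_partition :: "real poly list \<Rightarrow> ereal list option" where
  "sturm_partition ps = do {
     xs \<leftarrow> cut_points ps (- root_bound ps) (root_bound ps);
     Some (-\<infinity> # map ereal xs @ [\<infinity>])
   }"


section \<open>The algorithm\<close>

text \<open>
  \<open>char_poly_pencil R\<close> is the determinant of \<open>R + x * hodge - \<lambda> Id\<close> as a polynomial in \<open>\<lambda>\<close> (outer
  variable) with coefficients in \<open>\<real>[x]\<close>.
\<close>

definition char_poly_pencil :: "real^6^6 \<Rightarrow> real poly poly" where
  "char_poly_pencil R =
     det (\<chi> i j. [:[:R$i$j, hodge$i$j:]:] - (if i = j then [:0, 1:] else 0))"

definition sigma :: "real^6^6 \<Rightarrow> nat \<Rightarrow> real poly" where
  "sigma R i = (-1) ^ i * coeff (char_poly_pencil R) (6 - i)"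

text \<open>
  Some of the \<open>sigma R i\<close> may be the zero polynomial (e.g. \<open>sigma R 1\<close>, if \<open>R\<close> has trace \<open>0\<close>),
  which is nonzero at no point; only the others have to be isolated.  The test performed by
  \<open>verdict\<close> still involves all six of them.
\<close>

definition nonzero_sigmas :: "real^6^6 \<Rightarrow> real poly list" where
  "nonzero_sigmas R = filter (\<lambda>p. p \<noteq> 0) (map (sigma R) [1..<7])"

definition verdict :: "real^6^6 \<Rightarrow> ereal list \<Rightarrow> bool" where
  "verdict R as \<longleftrightarrow> (\<exists>a\<in>set as. \<forall>i\<in>{1..6}. poly_at (sigma R i) a > 0)"

text \<open>The algorithm terminates on input \<open>R\<close> iff \<open>sec_algorithm R\<close> is not \<open>None\<close>.\<close>

definition sec_algorithm :: "real^6^6 \<Rightarrow> bool option" where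
  "sec_algorithm R = do {
     as \<leftarrow> sturm_partition (nonzero_sigmas R);
     Some (verdict R as)
   }"


section \<open>Consistency of the definitions\<close>

lemma exhaust_6:
  fixes i :: 6
  shows "i = 1 \<or> i = 2 \<or> i = 3 \<or> i = 4 \<or> i = 5 \<or> i = 6"
proof (induct i)
  case (of_int z)
  then have "0 \<le> z" and "z < 6" by simp_all
  then have "z = 0 \<or> z = 1 \<or> z = 2 \<or> z = 3 \<or> z = 4 \<or> z = 5" by arith
  then show ?case by auto
qed

lemma UNIV_6: "(UNIV :: 6 set) = {1, 2, 3, 4, 5, 6}"
  using exhaust_6 by auto

lemma sum_6: "sum f (UNIV :: 6 set) = f 1 + f 2 + f 3 + f 4 + f 5 + f 6"
  unfolding UNIV_6 by (simp add: ac_simps)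

lemma vector_6:
  "(vector [a, b, c, d, e, f] :: 'a::zero^6) $ 1 = a"
  "(vector [a, b, c, d, e, f] :: 'a::zero^6) $ 2 = b"
  "(vector [a, b, c, d, e, f] :: 'a::zero^6) $ 3 = c"
  "(vector [a, b, c, d, e, f] :: 'a::zero^6) $ 4 = d"
  "(vector [a, b, c, d, e, f] :: 'a::zero^6) $ 5 = e"
  "(vector [a, b, c, d, e, f] :: 'a::zero^6) $ 6 = f"
  unfolding vector_def by auto

lemma inner_wedge:
  "wedge X Y \<bullet> wedge Z W = (X \<bullet> Z) * (Y \<bullet> W) - (X \<bullet> W) * (Y \<bullet> Z)"
  by (simp add: wedge_def inner_vec_def sum_6 sum_4 vector_6 algebra_simps)

lemma det_4:
  "det (A::real^4^4) =
     A$1$1 * (A$2$2 * (A$3$3 * A$4$4 - A$3$4 * A$4$3) - A$2$3 * (A$3$2 * A$4$4 - A$3$4 * A$4$2)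
              + A$2$4 * (A$3$2 * A$4$3 - A$3$3 * A$4$2))
   - A$1$2 * (A$2$1 * (A$3$3 * A$4$4 - A$3$4 * A$4$3) - A$2$3 * (A$3$1 * A$4$4 - A$3$4 * A$4$1)
              + A$2$4 * (A$3$1 * A$4$3 - A$3$3 * A$4$1))
   + A$1$3 * (A$2$1 * (A$3$2 * A$4$4 - A$3$4 * A$4$2) - A$2$2 * (A$3$1 * A$4$4 - A$3$4 * A$4$1)
              + A$2$4 * (A$3$1 * A$4$2 - A$3$2 * A$4$1))
   - A$1$4 * (A$2$1 * (A$3$2 * A$4$3 - A$3$3 * A$4$2) - A$2$2 * (A$3$1 * A$4$3 - A$3$3 * A$4$1)
              + A$2$3 * (A$3$1 * A$4$2 - A$3$2 * A$4$1))"
proof -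
  have f1: "finite {2::4, 3, 4}" "1 \<notin> {2::4, 3, 4}"
    and f2: "finite {3::4, 4}" "2 \<notin> {3::4, 4}"
    and f3: "finite {4::4}" "3 \<notin> {4::4}" by auto
  show ?thesis
    unfolding det_def UNIV_4
    unfolding sum_over_permutations_insert[OF f1] sum_over_permutations_insert[OF f2]
      sum_over_permutations_insert[OF f3]
    unfolding permutes_sing
    by (simp add: sign_swap_id permutation_swap_id permutation_compose sign_compose sign_id
        swap_id_eq) (simp add: algebra_simps)
qed

lemma vol_wedge_wedge:
  "vol_wedge (wedge X Y) (wedge Z W) = det (vector [X, Y, Z, W] :: real^4^4)"
proof -
  have v: "(vector [X, Y, Z, W] :: real^4^4) $ 1 = X" "(vector [X, Y, Z, W] :: real^4^4) $ 2 = Y"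
    "(vector [X, Y, Z, W] :: real^4^4) $ 3 = Z" "(vector [X, Y, Z, W] :: real^4^4) $ 4 = W"
    unfolding vector_def by auto
  show ?thesis
    unfolding det_4 v by (simp add: vol_wedge_def wedge_def vector_6 algebra_simps)
qed

lemma hodge_inner: "(hodge *v a) \<bullet> b = vol_wedge a b"
  by (simp add: hodge_def vol_wedge_def matrix_vector_mult_def inner_vec_def sum_6 axis_def
      algebra_simps)

text \<open>The identity by which the \<open>sigma R i\<close> are introduced.\<close>

lemma sigma_identity:
  "det (R + x *\<^sub>R hodge - l *\<^sub>R mat 1) =
     l ^ 6 + (\<Sum>i=1..6. (-1) ^ i * poly (sigma R i) x * l ^ (6 - i))"
proof -
  define E :: "6 \<Rightarrow> 6 \<Rightarrow> real poly poly" where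
    "E = (\<lambda>i j. [:[:R$i$j, hodge$i$j:]:] - (if i = j then [:0, 1:] else 0))"
  define P where "P = char_poly_pencil R"
  have P: "P = (\<Sum>p | p permutes UNIV. of_int (sign p) * (\<Prod>i\<in>UNIV. E i (p i)))"
    by (simp add: P_def char_poly_pencil_def det_def E_def)
  have evE: "poly (poly (E i j) [:l:]) x = (R + x *\<^sub>R hodge - l *\<^sub>R mat 1) $ i $ j" for i j
    by (simp add: E_def mat_def)
  have ev: "poly (poly P [:l:]) x = det (R + x *\<^sub>R hodge - l *\<^sub>R mat 1)"
    unfolding P det_def by (simp add: poly_sum poly_prod evE)
  have degE: "degree (E i j) \<le> (if i = j then 1 else 0)" for i j
    by (auto simp: E_def)
  have deg_prod: "degree (\<Prod>i\<in>UNIV. E i (p i)) \<le> card {i. p i = i}" for p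
  proof -
    have "degree (\<Prod>i\<in>UNIV. E i (p i)) \<le> (\<Sum>i\<in>UNIV. degree (E i (p i)))"
      using degree_prod_sum_le[of UNIV "\<lambda>i. E i (p i)"] by (simp add: o_def)
    also have "\<dots> \<le> (\<Sum>i\<in>UNIV. if p i = i then 1 else 0)"
      by (intro sum_mono order_trans[OF degE]) auto
    also have "\<dots> = card {i. p i = i}"
      by (simp add: sum.If_cases)
    finally show ?thesis .
  qed
  have off: "degree (\<Prod>i\<in>UNIV. E i (p i)) < 6" if "p \<noteq> id" for p
  proof -
    from that obtain k where "p k \<noteq> k" by (auto simp: fun_eq_iff)
    then have "{i. p i = i} \<subset> UNIV" by auto
    then have "card {i. p i = i} < card (UNIV :: 6 set)" by (intro psubset_card_mono) auto
    with deg_prod[of p] show ?thesis by simp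
  qed
  have deg_sgn: "degree (of_int (sign p) * q) \<le> degree q" for p :: "6 \<Rightarrow> 6" and q :: "real poly poly"
    by (cases p rule: sign_cases) auto
  have diag: "degree (E i i) = 1" "lead_coeff (E i i) = -1" for i
    by (auto simp: E_def)
  have "degree (\<Prod>i\<in>UNIV. E i i) = (\<Sum>i\<in>(UNIV::6 set). degree (E i i))"
    by (intro degree_prod_eq_sum_degree) (metis diag(1) degree_0 zero_neq_one)
  then have deg_id: "degree (\<Prod>i\<in>UNIV. E i i) = 6" by (simp add: diag)
  have "lead_coeff (\<Prod>i\<in>UNIV. E i i) = (\<Prod>i\<in>(UNIV::6 set). lead_coeff (E i i))"
    by (rule lead_coeff_prod)
  also have "\<dots> = 1" by (subst diag(2)) simp
  finally have lc_id: "coeff (\<Prod>i\<in>UNIV. E i i) 6 = 1" using deg_id by simp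
  have degP: "degree P \<le> 6"
    unfolding P
  proof (rule degree_sum_le)
    fix p assume "p \<in> {p. p permutes (UNIV :: 6 set)}"
    show "degree (of_int (sign p) * (\<Prod>i\<in>UNIV. E i (p i))) \<le> 6"
      using deg_sgn[of p "\<Prod>i\<in>UNIV. E i (p i)"] off[of p] deg_id by (cases "p = id") auto
  qed (simp add: finite_permutations)
  have "coeff P 6 = (\<Sum>p | p permutes (UNIV :: 6 set). if p = id then 1 else 0)"
    unfolding P coeff_sum
  proof (rule sum.cong)
    fix p assume "p \<in> {p. p permutes (UNIV :: 6 set)}"
    show "coeff (of_int (sign p) * (\<Prod>i\<in>UNIV. E i (p i))) 6 = (if p = id then 1 else 0)"
    proof (cases "p = id")
      case True
      then show ?thesis using lc_id by (simp add: sign_id)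
    next
      case False
      have "degree (of_int (sign p) * (\<Prod>i\<in>UNIV. E i (p i))) < 6"
        using deg_sgn[of p "\<Prod>i\<in>UNIV. E i (p i)"] off[OF False] by simp
      then show ?thesis using False by (simp add: coeff_eq_0)
    qed
  qed simp
  also have "\<dots> = 1" by (simp add: sum.delta finite_permutations permutes_id)
  finally have top: "coeff P 6 = 1" .
  have "poly P [:l:] = (\<Sum>i\<le>6. coeff P i * [:l:] ^ i)"
    unfolding poly_altdef using degP by (intro sum.mono_neutral_left) (auto simp: coeff_eq_0)
  then have "poly (poly P [:l:]) x = (\<Sum>i\<le>6. poly (coeff P i) x * l ^ i)"
    by (simp add: poly_sum poly_power)
  also have "\<dots> = l ^ 6 + (\<Sum>i=1..6. (-1) ^ i * poly (sigma R i) x * l ^ (6 - i))"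
    using top
    by (simp add: sigma_def P_def[symmetric] numeral_eq_Suc atMost_Suc atLeastAtMostSuc_conv)
  finally show ?thesis using ev by simp
qed

end

theory Submission
  imports Defs "HOL-Computational_Algebra.Fundamental_Theorem_Algebra"
begin

text \<open>
  By a lemma of Finsler, a quadratic form that is positive on the nonzero null vectors of an
  indefinite form becomes positive definite after adding a multiple of the latter. The null
  bivectors of the Hodge star are the decomposable ones, so \<open>sec_pos R\<close> holds iff
  \<open>R + x * hodge\<close> is positive definite for some \<open>x\<close>. All eigenvalues being real, this means that all
  six \<open>sigma R i\<close> are positive at \<open>x\<close>. The set of such \<open>x\<close> is open and bounded; if it is
  nonempty, each of its components is an interval whose endpoints are roots of some of the
  \<open>sigma R i\<close>, and every common root-isolating partition has a point inside.

  The bisection ends once the intervals are shorter than the distance between distinct roots, since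
  its tests are exact by Sturm's theorem. The latter holds because the number of sign variations
  just to the right of \<open>x\<close>, plus the number of roots up to \<open>x\<close>, is a locally constant
  function of \<open>x\<close>.
\<close>

section \<open>Sturm's theorem\<close>

text \<open>The polynomials to which Sturm's theorem is applied may have multiple roots, where all
  members of the Sturm chain vanish together. Signs are therefore attached to a point through the
  lowest nonvanishing Taylor coefficient and the parity of the order of vanishing, which keep their
  meaning at common zeros; no reduction to squarefree polynomials takes place. Diagonalization is
  avoided as well. With \<open>A = R + x * hodge\<close>, the \<open>sigma R i\<close> are the lower
  coefficients of \<open>det (A + m)\<close> as a polynomial in \<open>m\<close>. If they are
  positive, there is no root \<open>m \<ge> 0\<close>, so the minimum of the form on the unit
  sphere, being an eigenvalue, is positive. Conversely, for positive definite \<open>A\<close> all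
  complex roots are negative reals, and the polynomial is a product of factors \<open>m + r\<close>
  with \<open>r > 0\<close>. Points at infinity matter for one implication only: positive limits
  pass to finite parameters, whereas the point found for the converse is finite anyway.\<close>

lemma sign_changes_singleton [simp]: "sign_changes [x] = 0"
  by (simp add: sign_changes_def)

lemma sign_changes_Cons_Cons:
  assumes "x \<noteq> 0" "y \<noteq> 0"
  shows "sign_changes (x # y # zs) = (if sgn x = sgn y then 0 else 1) + sign_changes (y # zs)"
proof -
  have "sgn x \<noteq> 0" "sgn y \<noteq> 0" using assms by (auto simp: sgn_0_0)
  moreover have "length (remdups_adj (sgn y # ws)) \<ge> Suc 0" for ws :: "real list" by simp
  ultimately show ?thesis
    by (simp add: sign_changes_def)
qed

lemma sign_changes_Cons_zero: "sign_changes (x # 0 # zs) = sign_changes (x # zs)"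
  by (simp add: sign_changes_def)

text \<open>The sign of the lowest nonvanishing Taylor coefficient at \<open>x\<close>, which is the
  sign just to the right of \<open>x\<close>. For \<open>p \<noteq> 0\<close> it is never zero, even
  at a root.\<close>

definition local_sign :: "real poly \<Rightarrow> real \<Rightarrow> real" where
  "local_sign p x = sgn (poly (p div [:- x, 1:] ^ order x p) x)"

lemma order_decomp_local_sign:
  assumes "p \<noteq> 0"
  obtains u where "p = [:- x, 1:] ^ order x p * u" "poly u x \<noteq> 0" "local_sign p x = sgn (poly u x)"
proof -
  obtain u where u: "p = [:- x, 1:] ^ order x p * u" "\<not> [:- x, 1:] dvd u"
    using order_decomp[OF assms] by blast
  have "p div [:- x, 1:] ^ order x p = u"
    by (subst u(1)) simp
  with u that show ?thesis by (auto simp: local_sign_def poly_eq_0_iff_dvd)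
qed

lemma local_sign_eqI:
  assumes "p = [:- x, 1:] ^ n * u" "poly u x \<noteq> 0"
  shows "order x p = n" "local_sign p x = sgn (poly u x)"
proof -
  have "\<not> [:- x, 1:] ^ Suc n dvd p"
    using assms(2) unfolding assms(1) power_Suc2 by (subst dvd_mult_cancel_left) (auto simp: poly_eq_0_iff_dvd)
  with assms show n: "order x p = n"
    by (intro order_unique_lemma) auto
  show "local_sign p x = sgn (poly u x)"
    unfolding local_sign_def n by (subst assms(1)) simp
qed

lemma local_sign_nonzero: "p \<noteq> 0 \<Longrightarrow> local_sign p x = 1 \<or> local_sign p x = -1"
  by (erule order_decomp_local_sign[of p x]) (auto simp: sgn_if)

lemma local_sign_nonroot: "poly p x \<noteq> 0 \<Longrightarrow> local_sign p x = sgn (poly p x)"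
  using local_sign_eqI(2)[of p x 0 p] by simp

text \<open>Near \<open>x\<close> the cofactor of the power of \<open>y - x\<close> keeps its sign
  by continuity, so the two sides differ only through the parity of the order.\<close>

lemma eventually_sgn_poly:
  assumes "p \<noteq> 0"
  shows "eventually (\<lambda>y. sgn (poly p y) = local_sign p x) (at_right x)"
    and "eventually (\<lambda>y. sgn (poly p y) = (-1) ^ order x p * local_sign p x) (at_left x)"
proof -
  obtain u where u: "p = [:- x, 1:] ^ order x p * u" "poly u x \<noteq> 0" "local_sign p x = sgn (poly u x)"
    using order_decomp_local_sign[OF assms] .
  have lim: "((\<lambda>y. poly u y) \<longlongrightarrow> poly u x) (at x)"
    by (intro isContD poly_isCont)
  have ev: "eventually (\<lambda>y. sgn (poly u y) = sgn (poly u x)) (at x)"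
  proof (cases "poly u x > 0")
    case True
    from order_tendstoD(1)[OF lim True] show ?thesis
      by eventually_elim (use True in auto)
  next
    case False
    with u have "poly u x < 0" by auto
    from order_tendstoD(2)[OF lim this] show ?thesis
      by eventually_elim (use \<open>poly u x < 0\<close> in auto)
  qed
  have val: "sgn (poly p y) = sgn (y - x) ^ order x p * sgn (poly u y)" for y
    by (subst u(1)) (simp add: sgn_mult poly_power power_sgn)
  have "eventually (\<lambda>y. y > x) (at_right x)" by (simp add: eventually_at_filter)
  moreover have "eventually (\<lambda>y. sgn (poly u y) = sgn (poly u x)) (at_right x)"
    using ev by (simp add: eventually_at_split)
  ultimately show "eventually (\<lambda>y. sgn (poly p y) = local_sign p x) (at_right x)"
    by eventually_elim (simp add: val u(3))
  have "eventually (\<lambda>y. y < x) (at_left x)" by (simp add: eventually_at_filter)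
  moreover have "eventually (\<lambda>y. sgn (poly u y) = sgn (poly u x)) (at_left x)"
    using ev by (simp add: eventually_at_split)
  ultimately show "eventually (\<lambda>y. sgn (poly p y) = (-1) ^ order x p * local_sign p x) (at_left x)"
    by eventually_elim (simp add: val u(3))
qed

text \<open>The numbers of sign variations just to the right and just to the left of \<open>x\<close>, where no member of
  the list vanishes.\<close>

definition sturm_var_right :: "real poly list \<Rightarrow> real \<Rightarrow> nat" where
  "sturm_var_right ps x = sign_changes (map (\<lambda>p. local_sign p x) ps)"

definition sturm_var_left :: "real poly list \<Rightarrow> real \<Rightarrow> nat" where
  "sturm_var_left ps x = sign_changes (map (\<lambda>p. (-1) ^ order x p * local_sign p x) ps)"

text \<open>The term of lower order dominates near \<open>x\<close>. In a Euclidean step it shows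
  that the new remainder behaves like \<open>- p\<close> wherever \<open>q\<close> vanishes to
  higher order than \<open>p\<close>.\<close>

lemma local_sign_diff:
  assumes "p \<noteq> 0" "order x p < order x q \<or> q = 0"
  shows "order x (q - p) = order x p" "local_sign (q - p) x = - local_sign p x" "q - p \<noteq> 0"
proof -
  define m where "m = order x p"
  obtain u where u: "p = [:- x, 1:] ^ m * u" "poly u x \<noteq> 0" "local_sign p x = sgn (poly u x)"
    using order_decomp_local_sign[OF assms(1)] unfolding m_def .
  have "[:- x, 1:] ^ Suc m dvd q"
  proof (cases "q = 0")
    case False
    with assms have "Suc m \<le> order x q" by (auto simp: m_def)
    then show ?thesis by (rule order_divides[THEN iffD2, OF disjI2])
  qed simp
  then obtain w where w: "q = [:- x, 1:] ^ Suc m * w" by (rule dvdE)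
  have *: "q - p = [:- x, 1:] ^ m * ([:- x, 1:] * w - u)"
    by (simp add: u(1) w algebra_simps)
  have **: "poly ([:- x, 1:] * w - u) x = - poly u x" by simp
  show "order x (q - p) = order x p" "local_sign (q - p) x = - local_sign p x"
    using local_sign_eqI[OF *] u(2,3) ** by (simp_all add: m_def sgn_minus)
  show "q - p \<noteq> 0" using assms by auto
qed

lemma order_diff_ge:
  fixes p q :: "'a::idom poly"
  assumes "q - p \<noteq> 0" "p = 0 \<or> m \<le> order x p" "q = 0 \<or> m \<le> order x q"
  shows "m \<le> order x (q - p)"
proof -
  have "[:- x, 1:] ^ m dvd p" "[:- x, 1:] ^ m dvd q"
    using assms by (simp_all add: order_divides)
  then have "[:- x, 1:] ^ m dvd (q - p)" by (rule dvd_diff[OF _ _, rotated])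
  with assms show ?thesis by (simp add: order_divides)
qed

section \<open>Sturm chains and the local jump of their sign variations\<close>

lemma sturm_chain_nonempty: "\<exists>ps. sturm_chain p q = p # ps"
  by (subst sturm_chain.simps) auto

lemma sturm_chain_nonzero: "p \<noteq> 0 \<Longrightarrow> r \<in> set (sturm_chain p q) \<Longrightarrow> r \<noteq> 0"
proof (induction p q rule: sturm_chain.induct)
  case (1 p q)
  then show ?case by (cases "q = 0") (auto simp: sturm_chain.simps[of p q] sturm_chain.simps[of p 0])
qed

text \<open>The jump of \<open>sgn (p q)\<close> across \<open>x\<close>. Half of it is the contribution of \<open>x\<close> to the Cauchy index
  of \<open>q / p\<close> if \<open>x\<close> is a pole; otherwise \<open>x\<close> contributes nothing.\<close>

definition sign_jump :: "real poly \<Rightarrow> real poly \<Rightarrow> real \<Rightarrow> real" where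
  "sign_jump p q x = local_sign p x * local_sign q x * (1 - (-1) ^ (order x p + order x q))"

text \<open>Two signs with product \<open>e\<close> contribute \<open>(1 - e) / 2\<close>
  variations, so the first pair changes the count by half the jump of that product.\<close>

lemma sturm_var_Cons:
  assumes "p \<noteq> 0" "q \<noteq> 0"
  shows "real (sturm_var_left (p # q # ps) x) - real (sturm_var_right (p # q # ps) x)
    = sign_jump p q x / 2 + (real (sturm_var_left (q # ps) x) - real (sturm_var_right (q # ps) x))"
proof -
  define s t where st: "s = local_sign p x" "t = local_sign q x"
  have s: "s = 1 \<or> s = -1" and t: "t = 1 \<or> t = -1"
    using local_sign_nonzero assms by (auto simp: st)
  have "even (order x p) \<or> odd (order x p)" "even (order x q) \<or> odd (order x q)" by auto
  then show ?thesis
    unfolding sturm_var_left_def sturm_var_right_def sign_jump_def list.map st[symmetric]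
    using s t
    by (elim disjE) (simp_all add: sign_changes_Cons_Cons power_add)
qed

text \<open>The tail of the chain contributes exactly when \<open>p\<close> has lower order at
  \<open>x\<close> than \<open>q\<close>. Then the remainder behaves like \<open>- p\<close>, and
  its contribution cancels that of the first pair. At equal orders the total order of the first pair
  is even, so there is no jump at all.\<close>

lemma sturm_var_jump:
  assumes "p \<noteq> 0"
  shows "real (sturm_var_left (sturm_chain p q) x) - real (sturm_var_right (sturm_chain p q) x)
    = (if q \<noteq> 0 \<and> order x q < order x p then sign_jump p q x / 2 else 0)"
  using assms
proof (induction p q rule: sturm_chain.induct)
  case (1 p q)
  show ?case
  proof (cases "q = 0")
    case True
    then show ?thesis
      by (simp add: sturm_chain.simps sturm_var_left_def sturm_var_right_def)
  next
    case False
    define r where "r = - (p mod q)"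
    have r: "r = (p div q) * q - p"
      unfolding r_def by (simp add: minus_div_mult_eq_mod[symmetric])
    obtain ps where ps: "sturm_chain q r = q # ps" using sturm_chain_nonempty by blast
    have chain: "sturm_chain p q = p # q # ps"
      using False by (subst sturm_chain.simps) (simp add: r_def[symmetric] ps)
    have IH: "real (sturm_var_left (q # ps) x) - real (sturm_var_right (q # ps) x)
      = (if r \<noteq> 0 \<and> order x r < order x q then sign_jump q r x / 2 else 0)"
      using "1.IH"[OF False False] by (simp add: r_def[symmetric] ps)
    have ord: "p div q * q = 0 \<or> order x q \<le> order x (p div q * q)"
      using order_mult[of "p div q" q x] by linarith
    consider "order x q < order x p" | "order x p = order x q" | "order x p < order x q" by linarith
    then show ?thesis
    proof cases
      case 1
      then have "\<not> (r \<noteq> 0 \<and> order x r < order x q)"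
        using order_diff_ge[of "p div q * q" p "order x q" x] ord by (auto simp: r)
      with 1 show ?thesis
        unfolding chain sturm_var_Cons[OF \<open>p \<noteq> 0\<close> False] IH using False by auto
    next
      case 2
      then have "\<not> (r \<noteq> 0 \<and> order x r < order x q)"
        using order_diff_ge[of "p div q * q" p "order x q" x] ord by (auto simp: r)
      with 2 show ?thesis
        unfolding chain sturm_var_Cons[OF \<open>p \<noteq> 0\<close> False] IH using False
        by (auto simp: sign_jump_def)
    next
      case 3
      then have "order x p < order x (p div q * q) \<or> p div q * q = 0" using ord by auto
      note d = local_sign_diff[OF \<open>p \<noteq> 0\<close> this]
      with 3 show ?thesis
        unfolding chain sturm_var_Cons[OF \<open>p \<noteq> 0\<close> False] IH using False
        by (simp add: r sign_jump_def algebra_simps diff_divide_distrib)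
    qed
  qed
qed

text \<open>At a root of order \<open>n + 1\<close> the derivative has order \<open>n\<close> and
  the same local sign, because differentiation multiplies the lowest coefficient by
  \<open>n + 1\<close>. The total order is odd, so the jump is 2 whatever the multiplicity.\<close>

lemma sturm_var_pderiv:
  assumes "p \<noteq> 0"
  shows "int (sturm_var_left (sturm_chain p (pderiv p)) x)
    = int (sturm_var_right (sturm_chain p (pderiv p)) x) + (if poly p x = 0 then 1 else 0)"
proof -
  have "real (sturm_var_left (sturm_chain p (pderiv p)) x) - real (sturm_var_right (sturm_chain p (pderiv p)) x)
    = (if poly p x = 0 then 1 else 0)"
  proof (cases "poly p x = 0")
    case False
    then have "order x p = 0" by (simp add: order_root)
    with False sturm_var_jump[OF assms, of "pderiv p" x] show ?thesis by simp
  next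
    case True
    then obtain n where n: "order x p = Suc n"
      using assms by (metis not0_implies_Suc order_root)
    obtain u where u: "p = [:- x, 1:] ^ Suc n * u" "poly u x \<noteq> 0" "local_sign p x = sgn (poly u x)"
      using order_decomp_local_sign[OF assms] unfolding n[symmetric] .
    define v where "v = smult (of_nat (Suc n)) u + [:- x, 1:] * pderiv u"
    have "pderiv p = [:- x, 1:] ^ n * v"
      unfolding u(1) pderiv_mult pderiv_power_Suc v_def
      by (simp add: pderiv_pCons algebra_simps)
    moreover have v: "poly v x = real (Suc n) * poly u x" by (simp add: v_def)
    ultimately have o: "order x (pderiv p) = n" "local_sign (pderiv p) x = sgn (poly v x)"
      using local_sign_eqI[of "pderiv p" x n v] u by auto
    have "sgn (poly v x) = sgn (poly u x)" by (simp only: v sgn_mult) simp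
    moreover have "pderiv p \<noteq> 0"
    proof
      assume "pderiv p = 0"
      then obtain c where "p = [:c:]" by (auto simp: pderiv_eq_0_iff elim: degree_eq_zeroE)
      with assms True show False by simp
    qed
    moreover have "sgn (poly u x) * sgn (poly u x) = 1" using u(2) by (auto simp: sgn_if)
    ultimately show ?thesis
      using True sturm_var_jump[OF assms, of "pderiv p" x] n o u(3)
      by (simp add: sign_jump_def)
  qed
  then show ?thesis by (auto split: if_splits)
qed

text \<open>A zero entry \<open>q(x) = 0\<close> is harmless, since its neighbours \<open>p(x)\<close> and \<open>- (p mod q)(x)\<close> have opposite signs.\<close>

lemma sign_changes_sturm_chain_aux:
  "(poly p x \<noteq> 0 \<longrightarrow>
      sign_changes (map (\<lambda>r. poly r x) (sturm_chain p q)) = sturm_var_right (sturm_chain p q) x) \<and>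
   (q \<noteq> 0 \<longrightarrow> poly q x \<noteq> 0 \<longrightarrow>
      sign_changes (map (\<lambda>r. poly r x) (sturm_chain q (- (p mod q))))
        = sturm_var_right (sturm_chain q (- (p mod q))) x)"
proof (induction p q rule: sturm_chain.induct)
  case (1 p q)
  show ?case
  proof (cases "q = 0")
    case True
    then show ?thesis
      by (simp add: sturm_chain.simps sturm_var_right_def)
  next
    case False
    define r where "r = - (p mod q)"
    have r: "r = (p div q) * q - p"
      unfolding r_def by (simp add: minus_div_mult_eq_mod[symmetric])
    note IH = "1.IH"[OF False, folded r_def]
    obtain ps where ps: "sturm_chain q r = q # ps" using sturm_chain_nonempty by blast
    have chain: "sturm_chain p q = p # q # ps"
      using False by (subst sturm_chain.simps) (simp add: r_def[symmetric] ps)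
    have "sign_changes (map (\<lambda>r. poly r x) (p # q # ps)) = sturm_var_right (p # q # ps) x"
      if px: "poly p x \<noteq> 0"
    proof (cases "poly q x = 0")
      case qx: False
      have "local_sign p x \<noteq> 0" "local_sign q x \<noteq> 0"
        using px qx by (simp_all add: local_sign_nonroot sgn_0_0)
      then show ?thesis
        using IH qx px
        by (simp add: ps sturm_var_right_def sign_changes_Cons_Cons local_sign_nonroot)
    next
      case qx: True
      have rx: "poly r x = - poly p x" by (simp add: r qx)
      with px have r0: "r \<noteq> 0" by auto
      define s where "s = - (q mod r)"
      obtain rs where rs: "sturm_chain r s = r # rs" using sturm_chain_nonempty by blast
      have ps': "ps = r # rs"
        using ps r0 by (subst (asm) sturm_chain.simps) (simp add: s_def[symmetric] rs)
      have "local_sign q x = 1 \<or> local_sign q x = -1" using False by (rule local_sign_nonzero)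
      moreover have "sgn (poly p x) = 1 \<or> sgn (poly p x) = -1" using px by (auto simp: sgn_if)
      moreover have "local_sign r x = - sgn (poly p x)"
        using px rx by (simp add: local_sign_nonroot sgn_minus)
      \<comment> \<open>The second conjunct of the induction hypothesis, for the pair
        \<open>q\<close>, \<open>r\<close>: a zero of \<open>q\<close> makes the argument skip one
        member of the chain, which is why the claim also covers the next pair.\<close>
      moreover have "sign_changes (map (\<lambda>r. poly r x) (r # rs)) = sturm_var_right (r # rs) x"
        using IH r0 rx px by (simp add: s_def[symmetric] rs)
      ultimately show ?thesis
        using px rx
        by (auto simp: ps' qx sturm_var_right_def sign_changes_Cons_zero sign_changes_Cons_Cons
            local_sign_nonroot sgn_minus)
    qed
    then show ?thesis using IH by (simp add: chain ps r_def[symmetric])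
  qed
qed

lemma sign_changes_sturm_chain:
  "poly p x \<noteq> 0 \<Longrightarrow>
    sign_changes (map (\<lambda>r. poly r x) (sturm_chain p q)) = sturm_var_right (sturm_chain p q) x"
  using sign_changes_sturm_chain_aux by blast

section \<open>From local jumps to the global root count\<close>

lemma eventually_sturm_var_right:
  assumes "\<forall>p\<in>set ps. p \<noteq> 0"
  shows "eventually (\<lambda>y. sturm_var_right ps y = sturm_var_right ps x) (at_right x)"
    and "eventually (\<lambda>y. sturm_var_right ps y = sturm_var_left ps x) (at_left x)"
proof -
  have "eventually (\<lambda>y. \<forall>p\<in>set ps. sgn (poly p y) = local_sign p x) (at_right x)"
    using assms by (auto intro!: eventually_ball_finite eventually_sgn_poly)
  then show "eventually (\<lambda>y. sturm_var_right ps y = sturm_var_right ps x) (at_right x)"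
  proof eventually_elim
    case (elim y)
    have "local_sign p y = local_sign p x" if "p \<in> set ps" for p
    proof -
      have "poly p y \<noteq> 0" using elim that assms local_sign_nonzero[of p x] by (auto simp: sgn_0_0)
      with elim that show ?thesis by (simp add: local_sign_nonroot)
    qed
    then show ?case by (auto simp: sturm_var_right_def intro: arg_cong[where f = sign_changes])
  qed
  have "eventually (\<lambda>y. \<forall>p\<in>set ps. sgn (poly p y) = (-1) ^ order x p * local_sign p x) (at_left x)"
    using assms by (auto intro!: eventually_ball_finite eventually_sgn_poly)
  then show "eventually (\<lambda>y. sturm_var_right ps y = sturm_var_left ps x) (at_left x)"
  proof eventually_elim
    case (elim y)
    have "local_sign p y = (-1) ^ order x p * local_sign p x" if "p \<in> set ps" for p
    proof -
      have "poly p y \<noteq> 0" using elim that assms local_sign_nonzero[of p x] by (auto simp: sgn_0_0)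
      with elim that show ?thesis by (simp add: local_sign_nonroot)
    qed
    then show ?case
      by (auto simp: sturm_var_right_def sturm_var_left_def intro: arg_cong[where f = sign_changes])
  qed
qed

text \<open>Counting with \<open>\<le>\<close> is continuous from the right, as is
  \<open>sturm_var_right\<close>; its jump from the left balances the one in
  \<open>sturm_var_pderiv\<close>.\<close>

lemma eventually_card_le:
  fixes Z :: "real set"
  assumes "finite Z"
  shows "eventually (\<lambda>y. card {z\<in>Z. z \<le> y} = card {z\<in>Z. z \<le> x}) (at_right x)"
    and "eventually (\<lambda>y. card {z\<in>Z. z \<le> y} + (if x \<in> Z then 1 else 0) = card {z\<in>Z. z \<le> x}) (at_left x)"
proof -
  have "eventually (\<lambda>y. \<forall>z\<in>Z. (z \<le> y) = (z \<le> x)) (at_right x)"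
  proof (intro eventually_ball_finite assms ballI)
    fix z assume "z \<in> Z"
    show "eventually (\<lambda>y. (z \<le> y) = (z \<le> x)) (at_right x)"
    proof (cases "z \<le> x")
      case True
      then show ?thesis by (auto simp: eventually_at_filter)
    next
      case False
      then have "eventually (\<lambda>y. y < z) (at_right x)"
        by (intro order_tendstoD(2)[OF tendsto_ident_at]) auto
      then show ?thesis by eventually_elim (use False in auto)
    qed
  qed
  then show "eventually (\<lambda>y. card {z\<in>Z. z \<le> y} = card {z\<in>Z. z \<le> x}) (at_right x)"
    by eventually_elim (intro arg_cong[where f = card], auto)
  have "eventually (\<lambda>y. \<forall>z\<in>Z. (z \<le> y) = (z < x)) (at_left x)"
  proof (intro eventually_ball_finite assms ballI)
    fix z assume "z \<in> Z"
    show "eventually (\<lambda>y. (z \<le> y) = (z < x)) (at_left x)"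
    proof (cases "z < x")
      case False
      then show ?thesis by (auto simp: eventually_at_filter)
    next
      case True
      then have "eventually (\<lambda>y. z < y) (at_left x)"
        by (intro order_tendstoD(1)[OF tendsto_ident_at]) auto
      then show ?thesis by eventually_elim (use True in auto)
    qed
  qed
  then show "eventually (\<lambda>y. card {z\<in>Z. z \<le> y} + (if x \<in> Z then 1 else 0) = card {z\<in>Z. z \<le> x}) (at_left x)"
  proof eventually_elim
    case (elim y)
    then have *: "{z\<in>Z. z \<le> y} = {z\<in>Z. z < x}" by auto
    have **: "{z\<in>Z. z \<le> x} = (if x \<in> Z then insert x {z\<in>Z. z < x} else {z\<in>Z. z < x})"
      by (auto simp: order_le_less)
    show ?case unfolding * ** using assms by auto
  qed
qed

theorem sturm_count_eq_card:
  assumes "a < b" "poly p a \<noteq> 0" "poly p b \<noteq> 0"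
  shows "sturm_count p a b = int (card {x. a < x \<and> x < b \<and> poly p x = 0})"
proof -
  have p0: "p \<noteq> 0" using assms by auto
  define c where "c = sturm_chain p (pderiv p)"
  define Z where "Z = {x. poly p x = 0}"
  have fin: "finite Z" using poly_roots_finite[OF p0] by (simp add: Z_def)
  have nz: "\<forall>q\<in>set c. q \<noteq> 0" using sturm_chain_nonzero[OF p0] by (auto simp: c_def)
  define G where "G = (\<lambda>y. int (sturm_var_right c y) + int (card {z\<in>Z. z \<le> y}))"
  have "G a = G b"
  proof (rule connected_local_const[of UNIV _ _ G])
    show "\<forall>x\<in>UNIV. eventually (\<lambda>y. G x = G y) (at x)"
    proof
      fix x
      have "eventually (\<lambda>y. G x = G y) (at_right x)"
        using eventually_sturm_var_right(1)[OF nz] eventually_card_le(1)[OF fin]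
        by eventually_elim (simp add: G_def)
      moreover have "eventually (\<lambda>y. G x = G y) (at_left x)"
        using eventually_sturm_var_right(2)[OF nz] eventually_card_le(2)[OF fin]
        by eventually_elim
          (use sturm_var_pderiv[OF p0, of x] in \<open>auto simp: G_def Z_def c_def[symmetric] split: if_splits\<close>)
      ultimately show "eventually (\<lambda>y. G x = G y) (at x)" by (simp add: eventually_at_split)
    qed
  qed auto
  moreover have "card {z\<in>Z. z \<le> b} = card {z\<in>Z. z \<le> a} + card {x. a < x \<and> x < b \<and> poly p x = 0}"
  proof -
    have "{z\<in>Z. z \<le> b} = {z\<in>Z. z \<le> a} \<union> {x. a < x \<and> x < b \<and> poly p x = 0}"
      using assms by (auto simp: Z_def less_le)
    moreover have "finite {x. a < x \<and> x < b \<and> poly p x = 0}"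
      by (rule finite_subset[OF _ fin]) (auto simp: Z_def)
    ultimately show ?thesis using fin by (subst card_Un_disjoint[symmetric]) auto
  qed
  ultimately show ?thesis
    using sign_changes_sturm_chain assms(2,3) by (simp add: sturm_count_def G_def c_def)
qed

section \<open>Positive definite pencils\<close>

definition pos_def :: "real^'n^'n \<Rightarrow> bool" where
  "pos_def A \<longleftrightarrow> (\<forall>v. v \<noteq> 0 \<longrightarrow> (A *v v) \<bullet> v > 0)"

lemma symmetric_matrix_inner:
  fixes A :: "real^'n^'n"
  assumes "transpose A = A"
  shows "(A *v v) \<bullet> w = (A *v w) \<bullet> v"
  by (metis assms dot_lmul_matrix inner_commute transpose_matrix_vector)

lemma quadratic_form_add_scaleR:
  fixes A :: "real^'n^'n"
  assumes "transpose A = A"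
  shows "(A *v (v + t *\<^sub>R w)) \<bullet> (v + t *\<^sub>R w)
    = (A *v v) \<bullet> v + 2 * t * ((A *v v) \<bullet> w) + t\<^sup>2 * ((A *v w) \<bullet> w)"
  using symmetric_matrix_inner[OF assms, of v w]
  by (simp add: matrix_vector_right_distrib matrix_vector_mult_scaleR inner_add_left inner_add_right
      power2_eq_square algebra_simps)

lemma quadratic_form_scaleR:
  fixes A :: "real^'n^'n"
  shows "(A *v (t *\<^sub>R w)) \<bullet> (t *\<^sub>R w) = t\<^sup>2 * ((A *v w) \<bullet> w)"
  by (simp add: matrix_vector_mult_scaleR power2_eq_square)

lemma quadratic_form_pencil:
  fixes A B :: "real^'n^'n"
  shows "((A + x *\<^sub>R B) *v v) \<bullet> v = (A *v v) \<bullet> v + x * ((B *v v) \<bullet> v)"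
  by (simp add: matrix_vector_mult_add_rdistrib scaleR_matrix_vector_assoc[symmetric] inner_add_left)

lemma continuous_on_quadratic_form [continuous_intros]:
  fixes A :: "real^'n^'n" and f :: "'a::topological_space \<Rightarrow> real^'n"
  assumes "continuous_on S f"
  shows "continuous_on S (\<lambda>v. (A *v f v) \<bullet> f v)"
  by (intro continuous_intros assms bounded_linear.continuous_on[OF matrix_vector_mul_bounded_linear])

lemma pos_def_iff_unit:
  fixes A :: "real^'n^'n"
  shows "pos_def A \<longleftrightarrow> (\<forall>v. norm v = 1 \<longrightarrow> (A *v v) \<bullet> v > 0)"
proof
  assume *: "\<forall>v. norm v = 1 \<longrightarrow> (A *v v) \<bullet> v > 0"
  show "pos_def A"
    unfolding pos_def_def
  proof (intro allI impI)
    fix v :: "real^'n" assume "v \<noteq> 0"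
    define u where "u = (1 / norm v) *\<^sub>R v"
    have v: "v = norm v *\<^sub>R u" using \<open>v \<noteq> 0\<close> by (simp add: u_def)
    have "norm u = 1" using \<open>v \<noteq> 0\<close> by (simp add: u_def)
    then have "(A *v u) \<bullet> u > 0" using * by blast
    then show "(A *v v) \<bullet> v > 0"
      by (subst (1 2) v) (use \<open>v \<noteq> 0\<close> in \<open>simp only: quadratic_form_scaleR, simp\<close>)
  qed
next
  assume *: "pos_def A"
  show "\<forall>v. norm v = 1 \<longrightarrow> (A *v v) \<bullet> v > 0"
  proof (intro allI impI)
    fix v :: "real^'n" assume "norm v = 1"
    then have "v \<noteq> 0" by auto
    with * show "(A *v v) \<bullet> v > 0" unfolding pos_def_def by blast
  qed
qed

text \<open>On the plane spanned by \<open>v\<close> and \<open>w\<close>, subtracting the multiple of \<open>B\<close> that cancels \<open>A\<close> at \<open>w\<close>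
  makes \<open>A\<close> affine along the line \<open>v + t w\<close>; that line meets the null cone of \<open>B\<close> on both sides of \<open>v\<close>.\<close>

lemma quadratic_form_ratio:
  fixes A B :: "real^'n^'n"
  assumes A: "transpose A = A" and B: "transpose B = B"
    and null: "\<And>v. v \<noteq> 0 \<Longrightarrow> (B *v v) \<bullet> v = 0 \<Longrightarrow> (A *v v) \<bullet> v > 0"
    and v: "(B *v v) \<bullet> v > 0" and w: "(B *v w) \<bullet> w < 0"
  shows "(A *v w) \<bullet> w / ((B *v w) \<bullet> w) < (A *v v) \<bullet> v / ((B *v v) \<bullet> v)"
proof -
  define p n b where "p = (B *v v) \<bullet> v" and "n = - ((B *v w) \<bullet> w)" and "b = (B *v v) \<bullet> w"
  have p: "p > 0" and n: "n > 0" using v w by (auto simp: p_def n_def)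
  define k where "k = (A *v w) \<bullet> w / ((B *v w) \<bullet> w)"
  \<comment> \<open>A quarter of the discriminant of the form \<open>B\<close> along
    \<open>v + t w\<close>, under the root. As \<open>s\<close> exceeds
    \<open>\<bar>b\<bar>\<close>, the two zeros \<open>r\<close> and \<open>- q\<close> below have
    opposite signs.\<close>
  define s where "s = sqrt (b\<^sup>2 + n * p)"
  define c where "c = (A *v v) \<bullet> v - k * p"
  define d where "d = (A *v v) \<bullet> w - k * b"
  have s: "s\<^sup>2 = b\<^sup>2 + n * p" "s > \<bar>b\<bar>"
  proof -
    show "s\<^sup>2 = b\<^sup>2 + n * p" unfolding s_def using p n by simp
    have "sqrt (b\<^sup>2) < s" unfolding s_def using p n by (intro real_sqrt_less_mono) simp
    then show "s > \<bar>b\<bar>" by simp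
  qed
  have pos: "c + 2 * t * d > 0" if t: "p + 2 * t * b - t\<^sup>2 * n = 0" for t
  proof -
    let ?u = "v + t *\<^sub>R w"
    have Bu: "(B *v ?u) \<bullet> ?u = 0"
      unfolding quadratic_form_add_scaleR[OF B] using t by (simp add: p_def n_def b_def)
    have "?u \<noteq> 0"
    proof
      assume "?u = 0"
      then have "v = (- t) *\<^sub>R w" by (simp add: eq_neg_iff_add_eq_0)
      then have "p = (- t)\<^sup>2 * ((B *v w) \<bullet> w)" unfolding p_def using quadratic_form_scaleR by metis
      also have "\<dots> \<le> 0" using n by (simp add: n_def mult_nonneg_nonpos)
      finally show False using p by simp
    qed
    then have "(A *v ?u) \<bullet> ?u > 0" using null Bu by blast
    moreover have "(A *v ?u) \<bullet> ?u = c + 2 * t * d + k * (p + 2 * t * b - t\<^sup>2 * n)"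
      unfolding quadratic_form_add_scaleR[OF A] c_def d_def using n
      by (simp add: k_def n_def field_simps)
    ultimately show ?thesis using t by simp
  qed
  define r where "r = (b + s) / n"
  define q where "q = (s - b) / n"
  have r: "r > 0" and q: "q > 0" using s(2) n by (auto simp: r_def q_def)
  have root: "p + 2 * t * b - t\<^sup>2 * n = 0" if "n * t = b + e * s" "e\<^sup>2 = 1" for t e
  proof -
    have "n * (p + 2 * t * b - t\<^sup>2 * n) = n * p + 2 * b * (n * t) - (n * t)\<^sup>2"
      by (simp add: power2_eq_square algebra_simps)
    also have "\<dots> = n * p + b\<^sup>2 - e\<^sup>2 * s\<^sup>2"
      unfolding that(1) by (simp add: power2_eq_square algebra_simps)
    also have "\<dots> = 0" by (simp add: that(2) s(1))
    finally show ?thesis using n by simp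
  qed
  have "p + 2 * r * b - r\<^sup>2 * n = 0"
    using n by (intro root[of r 1]) (simp_all add: r_def)
  moreover have "p + 2 * (- q) * b - (- q)\<^sup>2 * n = 0"
    using n by (intro root[of "- q" "-1"]) (simp_all add: q_def)
  \<comment> \<open>The weights \<open>q\<close> and \<open>r\<close> cancel the slope
    \<open>d\<close>: up to the factor \<open>q + r\<close>, this combination is the value
    \<open>c\<close> of the affine function at \<open>t = 0\<close>.\<close>
  ultimately have "q * (c + 2 * r * d) + r * (c + 2 * (- q) * d) > 0"
    using pos[of r] pos[of "- q"] add_pos_pos[OF mult_pos_pos[OF q] mult_pos_pos[OF r]] by blast
  then have "(q + r) * c > 0" by (simp add: algebra_simps)
  then have "c > 0" using r q by (simp add: zero_less_mult_iff)
  then show ?thesis using p by (simp add: c_def k_def p_def field_simps)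
qed

text \<open>The two closed sets of parameters at which positivity fails on the half cone \<open>B \<ge> 0\<close>,
  respectively \<open>B \<le> 0\<close>, are disjoint and nonempty, so they do not cover the connected real line.\<close>

theorem finsler:
  fixes A B :: "real^'n^'n"
  assumes A: "transpose A = A" and B: "transpose B = B"
    and null: "\<And>v. v \<noteq> 0 \<Longrightarrow> (B *v v) \<bullet> v = 0 \<Longrightarrow> (A *v v) \<bullet> v > 0"
    and v: "(B *v v) \<bullet> v > 0" and w: "(B *v w) \<bullet> w < 0"
  shows "\<exists>x. pos_def (A + x *\<^sub>R B)"
proof -
  define P where "P = {x. \<exists>u. u \<in> sphere 0 1 \<and>
    (u, x) \<in> {z. 0 \<le> (B *v fst z) \<bullet> fst z \<and> (A *v fst z) \<bullet> fst z + snd z * ((B *v fst z) \<bullet> fst z) \<le> 0}}"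
  define N where "N = {x. \<exists>u. u \<in> sphere 0 1 \<and>
    (u, x) \<in> {z. (B *v fst z) \<bullet> fst z \<le> 0 \<and> (A *v fst z) \<bullet> fst z + snd z * ((B *v fst z) \<bullet> fst z) \<le> 0}}"
  have PN: "closed P" "closed N"
    unfolding P_def N_def
    by (intro closed_compact_projection closed_Collect_conj closed_Collect_le continuous_intros compact_sphere)+
  have "P \<inter> N = {}"
  proof (rule ccontr)
    assume "P \<inter> N \<noteq> {}"
    then obtain x u z where u: "norm u = 1" "0 \<le> (B *v u) \<bullet> u" "(A *v u) \<bullet> u + x * ((B *v u) \<bullet> u) \<le> 0"
      and z: "norm z = 1" "(B *v z) \<bullet> z \<le> 0" "(A *v z) \<bullet> z + x * ((B *v z) \<bullet> z) \<le> 0"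
      by (auto simp: P_def N_def)
    have "u \<noteq> 0" "z \<noteq> 0" using u z by auto
    have "(B *v u) \<bullet> u \<noteq> 0" "(B *v z) \<bullet> z \<noteq> 0"
      using null[OF \<open>u \<noteq> 0\<close>] null[OF \<open>z \<noteq> 0\<close>] u z by auto
    with u z have pos: "(B *v u) \<bullet> u > 0" "(B *v z) \<bullet> z < 0" by auto
    \<comment> \<open>Failure at \<open>x\<close> on both half cones puts \<open>- x\<close> between
      the two ratios, in the order excluded by \<open>quadratic_form_ratio\<close>.\<close>
    have "(A *v u) \<bullet> u / ((B *v u) \<bullet> u) \<le> - x" using u(3) pos by (simp add: field_simps)
    moreover have "- x \<le> (A *v z) \<bullet> z / ((B *v z) \<bullet> z)" using z(3) pos by (simp add: field_simps)
    moreover note quadratic_form_ratio[OF A B null pos]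
    ultimately show False by linarith
  qed
  moreover have unit: "\<exists>y. norm y = 1 \<and> sgn ((B *v y) \<bullet> y) = sgn ((B *v u) \<bullet> u)"
    if "(B *v u) \<bullet> u \<noteq> 0" for u
  proof -
    have "u \<noteq> 0" using that by auto
    then show ?thesis
      by (intro exI[of _ "(1 / norm u) *\<^sub>R u"], simp only: quadratic_form_scaleR)
        (simp add: sgn_mult)
  qed
  have "P \<noteq> {}"
  proof -
    obtain y where y: "norm y = 1" "(B *v y) \<bullet> y > 0" using unit[of v] v by (auto simp: sgn_if split: if_splits)
    \<comment> \<open>The parameter at which the pencil vanishes on \<open>y\<close>.\<close>
    then have "- ((A *v y) \<bullet> y) / ((B *v y) \<bullet> y) \<in> P"
      by (auto simp: P_def intro!: exI[of _ y])
    then show ?thesis by blast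
  qed
  moreover have "N \<noteq> {}"
  proof -
    obtain y where y: "norm y = 1" "(B *v y) \<bullet> y < 0" using unit[of w] w by (auto simp: sgn_if split: if_splits)
    then have "- ((A *v y) \<bullet> y) / ((B *v y) \<bullet> y) \<in> N"
      by (auto simp: N_def intro!: exI[of _ y])
    then show ?thesis by blast
  qed
  ultimately obtain x where x: "x \<notin> P" "x \<notin> N"
    using connected_closedD[OF connected_UNIV, of P N] PN by auto
  have "pos_def (A + x *\<^sub>R B)"
    unfolding pos_def_iff_unit quadratic_form_pencil
  proof (intro allI impI)
    fix u :: "real^'n" assume "norm u = 1"
    then show "(A *v u) \<bullet> u + x * ((B *v u) \<bullet> u) > 0"
      using x unfolding P_def N_def by (cases "(B *v u) \<bullet> u \<ge> 0") (auto simp: not_le)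
  qed
  then show ?thesis ..
qed

section \<open>Positive definiteness through the zeros of a determinant\<close>

lemma det_eq_zero_iff_kernel:
  fixes A :: "'a::field^'n^'n"
  shows "det A = 0 \<longleftrightarrow> (\<exists>v. v \<noteq> 0 \<and> A *v v = 0)"
  using invertible_det_nz[of A] invertible_left_inverse[of A] matrix_left_invertible_ker[of A] by auto

text \<open>A minimizer of the quadratic form on the unit sphere is an eigenvector for the minimum.\<close>

lemma pos_def_if_det_nonzero:
  fixes A :: "real^'n^'n"
  assumes A: "transpose A = A" and det: "\<And>m. m \<ge> 0 \<Longrightarrow> det (A + m *\<^sub>R mat 1) \<noteq> 0"
  shows "pos_def A"
proof -
  have "\<exists>u\<in>sphere (0::real^'n) 1. \<forall>v\<in>sphere 0 1. (A *v u) \<bullet> u \<le> (A *v v) \<bullet> v"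
    by (intro continuous_attains_inf continuous_intros) simp_all
  then obtain u where u: "norm u = 1" and min: "\<And>v. norm v = 1 \<Longrightarrow> (A *v u) \<bullet> u \<le> (A *v v) \<bullet> v"
    by auto
  define m where "m = (A *v u) \<bullet> u"
  have "m > 0"
  proof (rule ccontr)
    assume "\<not> m > 0"
    define D where "D = A + (- m) *\<^sub>R mat 1"
    have D: "transpose D = D" using A by (simp add: D_def transpose_def vec_eq_iff mat_def)
    have qD: "(D *v v) \<bullet> v = (A *v v) \<bullet> v - m * (norm v)\<^sup>2" for v
      unfolding D_def quadratic_form_pencil by (simp add: dot_square_norm)
    have nonneg: "(D *v v) \<bullet> v \<ge> 0" for v
    proof (cases "v = 0")
      case False
      then have "m \<le> (A *v ((1 / norm v) *\<^sub>R v)) \<bullet> ((1 / norm v) *\<^sub>R v)"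
        unfolding m_def by (intro min) simp
      also have "\<dots> = (A *v v) \<bullet> v / (norm v)\<^sup>2"
        unfolding quadratic_form_scaleR by (simp add: power_divide)
      finally show ?thesis using False by (simp add: qD field_simps)
    qed simp
    have Du: "(D *v u) \<bullet> u = 0" by (simp add: qD m_def u)
    define w where "w = D *v u"
    define q where "q = (D *v w) \<bullet> w"
    \<comment> \<open>Moving from \<open>u\<close> by \<open>- e\<close> along \<open>w\<close>,
      half the gradient, gives the value \<open>- 2 e |w|^2 + e^2 q\<close>. For this
      \<open>e\<close> it equals \<open>- e^2 (q + 2)\<close>, so nonnegativity forces
      \<open>e = 0\<close>; the summand 1 keeps the denominator positive.\<close>
    define e where "e = (norm w)\<^sup>2 / (q + 1)"
    have q: "q \<ge> 0" using nonneg by (simp add: q_def)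
    have "0 \<le> 2 * (- e) * (norm w)\<^sup>2 + (- e)\<^sup>2 * q"
      using nonneg[of "u + (- e) *\<^sub>R w"] unfolding quadratic_form_add_scaleR[OF D] Du
      by (simp add: w_def[symmetric] q_def dot_square_norm)
    also have "(norm w)\<^sup>2 = e * (q + 1)" using q by (simp add: e_def)
    also have "2 * (- e) * (e * (q + 1)) + (- e)\<^sup>2 * q = - e\<^sup>2 * (q + 2)"
      by (simp add: power2_eq_square algebra_simps)
    finally have "e = 0" using q by (auto simp: mult_le_0_iff zero_le_mult_iff)
    then have "D *v u = 0" using q by (simp add: e_def w_def)
    moreover have "u \<noteq> 0" using u by auto
    ultimately have "det D = 0" using det_eq_zero_iff_kernel by blast
    with det[of "- m"] \<open>\<not> m > 0\<close> show False by (simp add: D_def)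
  qed
  then show ?thesis using min unfolding pos_def_iff_unit m_def by (meson less_le_trans)
qed

text \<open>A kernel vector \<open>a + i b\<close> is an eigenvector of \<open>A\<close> for
  \<open>- z\<close>. Evaluating \<open>(A *v a) \<bullet> b\<close> in two ways by symmetry shows
  that \<open>Im z\<close> vanishes; then a nonzero one of \<open>a\<close> and \<open>b\<close> is
  a real eigenvector for \<open>- Re z\<close>.\<close>

lemma pos_def_complex_eigenvalue:
  fixes A :: "real^'n^'n"
  assumes A: "transpose A = A" "pos_def A"
    and det: "det (\<chi> i j. of_real (A $ i $ j) + (if i = j then z else 0) :: complex^'n^'n) = 0"
  shows "Im z = 0" "Re z < 0"
proof -
  obtain v where v: "v \<noteq> 0"
    "(\<chi> i j. of_real (A $ i $ j) + (if i = j then z else 0) :: complex^'n^'n) *v v = 0"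
    using det unfolding det_eq_zero_iff_kernel by blast
  define a b where "a = (\<chi> i. Re (v $ i))" and "b = (\<chi> i. Im (v $ i))"
  have sum: "(\<Sum>j\<in>UNIV. of_real (A $ i $ j) * v $ j) + z * v $ i = 0" for i
  proof -
    have "(\<Sum>j\<in>UNIV. (of_real (A $ i $ j) + (if i = j then z else 0)) * v $ j) = 0"
      using v(2) by (simp add: vec_eq_iff matrix_vector_mult_def)
    moreover have "(\<Sum>j\<in>UNIV. (of_real (A $ i $ j) + (if i = j then z else 0)) * v $ j)
      = (\<Sum>j\<in>UNIV. of_real (A $ i $ j) * v $ j) + (\<Sum>j\<in>UNIV. if i = j then z * v $ j else 0)"
      unfolding sum.distrib[symmetric] by (intro sum.cong) (auto simp: algebra_simps)
    ultimately show ?thesis by simp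
  qed
  have Aa: "A *v a = - (Re z *\<^sub>R a) + Im z *\<^sub>R b"
  proof -
    have "(A *v a) $ i + Re z * a $ i - Im z * b $ i = 0" for i
      using arg_cong[OF sum[of i], of Re] by (simp add: matrix_vector_mult_def a_def b_def)
    then show ?thesis by (simp add: vec_eq_iff algebra_simps)
  qed
  have Ab: "A *v b = - (Re z *\<^sub>R b) - Im z *\<^sub>R a"
  proof -
    have "(A *v b) $ i + Re z * b $ i + Im z * a $ i = 0" for i
      using arg_cong[OF sum[of i], of Im] by (simp add: matrix_vector_mult_def a_def b_def)
    then show ?thesis by (simp add: vec_eq_iff algebra_simps eq_neg_iff_add_eq_0)
  qed
  have ab: "a \<noteq> 0 \<or> b \<noteq> 0"
    using v(1) by (auto simp: vec_eq_iff a_def b_def complex_eq_iff)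
  have "Im z * (b \<bullet> b + a \<bullet> a) = 0"
    using symmetric_matrix_inner[OF A(1), of a b] unfolding Aa Ab
    by (simp add: inner_add_left inner_diff_left inner_commute algebra_simps)
  moreover have "b \<bullet> b + a \<bullet> a > 0"
    using ab by (metis add_pos_nonneg add_nonneg_pos inner_ge_zero inner_gt_zero_iff)
  ultimately show "Im z = 0" by simp
  with Aa Ab have eig: "A *v a = - (Re z *\<^sub>R a)" "A *v b = - (Re z *\<^sub>R b)" by simp_all
  obtain c where "c \<noteq> 0" "A *v c = - (Re z *\<^sub>R c)" using ab eig by blast
  moreover from this have "(A *v c) \<bullet> c > 0" using A(2) unfolding pos_def_def by blast
  ultimately have "Re z * (c \<bullet> c) < 0" "c \<bullet> c > 0" by simp_all
  then show "Re z < 0" by (simp add: mult_less_0_iff)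
qed

text \<open>Multiplication by \<open>X + r\<close> with \<open>r > 0\<close> preserves positivity of
  all coefficients. The complex setting lets the fundamental theorem of algebra split off such
  factors one by one.\<close>

lemma coeff_pos_if_roots_negative:
  fixes p :: "complex poly"
  assumes "lead_coeff p = 1" "\<And>z. poly p z = 0 \<Longrightarrow> Im z = 0 \<and> Re z < 0" "i \<le> degree p"
  shows "\<exists>c>0. coeff p i = of_real c"
  using assms
proof (induction "degree p" arbitrary: p i)
  case 0
  then show ?case by (intro exI[of _ 1]) auto
next
  case (Suc n)
  have "\<not> constant (poly p)" using Suc.hyps(2) by (simp add: constant_degree)
  then obtain z where z: "poly p z = 0" using fundamental_theorem_of_algebra by blast
  define r where "r = - Re z"
  have r: "r > 0" "z = - of_real r" using Suc.prems(2)[OF z] by (auto simp: r_def complex_eq_iff)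
  obtain q where q: "p = [:of_real r, 1:] * q"
    using z by (auto simp: poly_eq_0_iff_dvd r elim: dvdE)
  have "p \<noteq> 0" using Suc.prems(1) by auto
  then have "q \<noteq> 0" using q by auto
  then have deg: "degree p = Suc (degree q)" unfolding q by (subst degree_mult_eq) auto
  have lc: "lead_coeff q = 1" using Suc.prems(1) unfolding q lead_coeff_mult by simp
  have IH: "\<exists>c>0. coeff q j = of_real c" if "j \<le> degree q" for j
    using Suc.hyps(1)[of q j] Suc.hyps(2) deg lc Suc.prems(2) that by (simp add: q)
  have coeff: "coeff p i = of_real r * coeff q i + (if i = 0 then 0 else coeff q (i - 1))"
    unfolding q by (cases i) auto
  show ?case
  proof (cases "i \<le> degree q")
    case True
    then obtain c where c: "c > 0" "coeff q i = of_real c" using IH by blast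
    show ?thesis
    proof (cases i)
      case 0
      with c r coeff show ?thesis by (intro exI[of _ "r * c"]) auto
    next
      case (Suc j)
      then obtain d where d: "d > 0" "coeff q j = of_real d" using IH[of j] True by auto
      with c r coeff Suc show ?thesis by (intro exI[of _ "r * c + d"]) (auto intro: add_pos_pos)
    qed
  next
    case False
    with Suc.prems(3) deg have "i = Suc (degree q)" by simp
    with coeff lc have "coeff p i = 1" by (simp add: coeff_eq_0)
    then show ?thesis by (intro exI[of _ 1]) auto
  qed
qed

section \<open>Elementary symmetric polynomials of the eigenvalues\<close>

text \<open>The characteristic polynomial with its variable negated: as 6 is even, the alternating
  signs disappear and the \<open>sigma R i\<close> themselves become coefficients.\<close>

definition shifted_char_poly :: "real^6^6 \<Rightarrow> real \<Rightarrow> real poly" where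
  "shifted_char_poly R x = monom 1 6 + (\<Sum>i=1..6. monom (poly (sigma R i) x) (6 - i))"

lemma poly_shifted_char_poly:
  "poly (shifted_char_poly R x) m = det (R + x *\<^sub>R hodge + m *\<^sub>R mat 1)"
proof -
  have "(-1) ^ i * poly (sigma R i) x * (- m) ^ (6 - i) = poly (sigma R i) x * m ^ (6 - i)"
    if "i \<in> {1..6}" for i
  proof -
    have "i \<in> {1, 2, 3, 4, 5, 6}" using that by auto
    then show ?thesis by (auto simp: power_minus_odd)
  qed
  then have "(\<Sum>i=1..6. (-1) ^ i * poly (sigma R i) x * (- m) ^ (6 - i))
      = (\<Sum>i=1..6. poly (sigma R i) x * m ^ (6 - i))"
    by (rule sum.cong[OF refl])
  then show ?thesis
    using sigma_identity[of R x "- m"]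
    by (simp add: shifted_char_poly_def poly_sum poly_monom)
qed

lemma coeff_shifted_char_poly:
  assumes "i \<in> {1..6}"
  shows "coeff (shifted_char_poly R x) (6 - i) = poly (sigma R i) x"
proof -
  have "i \<in> {1, 2, 3, 4, 5, 6}" using assms by auto
  then show ?thesis
    by (auto simp: shifted_char_poly_def coeff_sum numeral_eq_Suc atLeastAtMostSuc_conv)
qed

lemma degree_shifted_char_poly: "degree (shifted_char_poly R x) = 6"
  and lead_coeff_shifted_char_poly: "coeff (shifted_char_poly R x) 6 = 1"
proof -
  have *: "degree (\<Sum>i=1..6. monom (poly (sigma R i) x) (6 - i)) < 6"
    by (rule degree_sum_less) (auto intro: le_less_trans[OF degree_monom_le])
  then show "degree (shifted_char_poly R x) = 6"
    unfolding shifted_char_poly_def by (subst degree_add_eq_left) (auto simp: degree_monom_eq)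
  show "coeff (shifted_char_poly R x) 6 = 1"
    using coeff_eq_0[OF *] by (simp add: shifted_char_poly_def)
qed

lemma poly_map_of_real: "poly (map_poly of_real p) (of_real x :: complex) = of_real (poly p x)"
  by (induction p) (auto simp: map_poly_pCons)

text \<open>Both sides are polynomials in \<open>z\<close> that agree at the infinitely many real
  points.\<close>

lemma poly_shifted_char_poly_complex:
  fixes z :: complex
  shows "poly (map_poly of_real (shifted_char_poly R x)) z
    = det (\<chi> i j. of_real ((R + x *\<^sub>R hodge) $ i $ j) + (if i = j then z else 0))"
proof -
  define A where "A = R + x *\<^sub>R hodge"
  define E :: "6 \<Rightarrow> 6 \<Rightarrow> complex poly" where
    "E = (\<lambda>i j. [:of_real (A $ i $ j):] + (if i = j then [:0, 1:] else 0))"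
  define P where "P = det (\<chi> i j. E i j)"
  have ev: "poly P z = det (\<chi> i j. of_real (A $ i $ j) + (if i = j then z else 0))" for z
    unfolding P_def det_def by (simp add: poly_sum poly_prod E_def if_distrib[of "\<lambda>p. poly p _"] cong: if_cong)
  have "poly P (of_real m) = poly (map_poly of_real (shifted_char_poly R x)) (of_real m)" for m
    unfolding poly_map_of_real poly_shifted_char_poly ev A_def[symmetric]
    by (simp add: det_def mat_def) (intro sum.cong prod.cong arg_cong2[where f = "(*)"]; simp)
  then have "range complex_of_real \<subseteq> {z. poly (P - map_poly of_real (shifted_char_poly R x)) z = 0}"
    by auto
  moreover have "infinite (range complex_of_real)"
    using infinite_UNIV_char_0 by (metis finite_imageD inj_of_real)
  ultimately have "P - map_poly of_real (shifted_char_poly R x) = 0"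
    using poly_roots_finite finite_subset by blast
  then show ?thesis using ev[of z] by (simp add: A_def)
qed

theorem pos_def_pencil_iff:
  assumes "transpose (R + x *\<^sub>R hodge) = R + x *\<^sub>R hodge"
  shows "pos_def (R + x *\<^sub>R hodge) \<longleftrightarrow> (\<forall>i\<in>{1..6}. poly (sigma R i) x > 0)"
proof
  assume pd: "pos_def (R + x *\<^sub>R hodge)"
  show "\<forall>i\<in>{1..6}. poly (sigma R i) x > 0"
  proof
    fix i :: nat assume i: "i \<in> {1..6}"
    let ?p = "map_poly complex_of_real (shifted_char_poly R x)"
    have deg: "degree ?p = 6" by (simp add: degree_map_poly degree_shifted_char_poly)
    have "\<exists>c>0. coeff ?p (6 - i) = of_real c"
    proof (rule coeff_pos_if_roots_negative)
      show "lead_coeff ?p = 1" by (simp add: deg coeff_map_poly lead_coeff_shifted_char_poly)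
      show "Im z = 0 \<and> Re z < 0" if "poly ?p z = 0" for z
        using pos_def_complex_eigenvalue[OF assms pd, of z] that
        unfolding poly_shifted_char_poly_complex by simp
    qed (simp add: deg)
    then show "poly (sigma R i) x > 0"
      using i by (auto simp: coeff_map_poly coeff_shifted_char_poly)
  qed
next
  assume *: "\<forall>i\<in>{1..6}. poly (sigma R i) x > 0"
  show "pos_def (R + x *\<^sub>R hodge)"
  proof (rule pos_def_if_det_nonzero[OF assms])
    fix m :: real assume m: "m \<ge> 0"
    have "poly (shifted_char_poly R x) m = m ^ 6 + (\<Sum>i=1..6. poly (sigma R i) x * m ^ (6 - i))"
      by (simp add: shifted_char_poly_def poly_sum poly_monom)
    \<comment> \<open>The constant term, which keeps the value positive even at
      \<open>m = 0\<close>.\<close>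
    moreover have "poly (sigma R 6) x * m ^ (6 - 6) \<le> (\<Sum>i=1..6. poly (sigma R i) x * m ^ (6 - i))"
    proof (rule member_le_sum)
      fix i assume "i \<in> {1..6} - {6::nat}"
      then have "poly (sigma R i) x > 0" using * by auto
      then show "0 \<le> poly (sigma R i) x * m ^ (6 - i)" using m by simp
    qed auto
    moreover have "poly (sigma R 6) x * m ^ (6 - 6) > 0" using * by simp
    moreover have "m ^ 6 \<ge> 0" using m by simp
    ultimately have "poly (shifted_char_poly R x) m > 0" by linarith
    then show "det (R + x *\<^sub>R hodge + m *\<^sub>R mat 1) \<noteq> 0"
      by (simp add: poly_shifted_char_poly)
  qed
qed

section \<open>Sectional curvature\<close>

lemma transpose_hodge: "transpose hodge = hodge"
  by (simp add: vec_eq_iff transpose_def hodge_def vol_wedge_def algebra_simps)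

lemma transpose_pencil: "transpose R = R \<Longrightarrow> transpose (R + x *\<^sub>R hodge) = R + x *\<^sub>R hodge"
  using transpose_hodge by (simp add: vec_eq_iff transpose_def)

lemma vector_4:
  "(vector [a, b, c, d] :: 'a::zero^4) $ 1 = a"
  "(vector [a, b, c, d] :: 'a::zero^4) $ 2 = b"
  "(vector [a, b, c, d] :: 'a::zero^4) $ 3 = c"
  "(vector [a, b, c, d] :: 'a::zero^4) $ 4 = d"
  unfolding vector_def by auto

lemma forall_6: "(\<forall>i::6. P i) \<longleftrightarrow> P 1 \<and> P 2 \<and> P 3 \<and> P 4 \<and> P 5 \<and> P 6"
  by (metis exhaust_6)

lemma vol_wedge_decomposable: "vol_wedge (wedge X Y) (wedge X Y) = 0"
  by (simp add: vol_wedge_def wedge_def vector_6 algebra_simps)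

text \<open>The factors are the rows \<open>i\<close> and \<open>j\<close> of the skew matrix of the bivector, for a nonzero
  entry \<open>(i, j)\<close>.\<close>

lemma decomposable_if_vol_wedge_zero:
  assumes "vol_wedge a a = 0"
  shows "\<exists>X Y. a = wedge X Y"
proof -
  define X1 X2 X3 X4 :: "real^4" where
    "X1 = vector [0, a$1, a$2, a$3]" and "X2 = vector [- a$1, 0, a$4, a$5]" and
    "X3 = vector [- a$2, - a$4, 0, a$6]" and "X4 = vector [- a$3, - a$5, - a$6, 0]"
  note rows = X1_def X2_def X3_def X4_def
  \<comment> \<open>The Pluecker relation, which makes the wedge of any two rows a multiple of
    \<open>a\<close>.\<close>
  have pf: "a$1 * a$6 = a$2 * a$5 - a$3 * a$4"
    using assms by (simp add: vol_wedge_def algebra_simps)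
  have prods: "wedge X1 X2 = a$1 *\<^sub>R a" "wedge X1 X3 = a$2 *\<^sub>R a" "wedge X1 X4 = a$3 *\<^sub>R a"
    "wedge X2 X3 = a$4 *\<^sub>R a" "wedge X2 X4 = a$5 *\<^sub>R a" "wedge X3 X4 = a$6 *\<^sub>R a"
    using pf unfolding vec_eq_iff forall_6
    by (simp_all add: wedge_def rows vector_6 vector_4 algebra_simps)
  have scale: "wedge ((1 / c) *\<^sub>R X) Y = (1 / c) *\<^sub>R wedge X Y" for c X Y
    unfolding vec_eq_iff forall_6
    by (simp add: wedge_def vector_6 algebra_simps diff_divide_distrib)
  have *: "\<exists>X Y. a = wedge X Y" if "wedge X Y = c *\<^sub>R a" "c \<noteq> 0" for c X Y
    using that by (intro exI[of _ "(1 / c) *\<^sub>R X"] exI[of _ Y]) (simp add: scale)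
  show ?thesis
  proof (cases "a = 0")
    case True
    then show ?thesis
      by (intro exI[of _ 0]) (simp add: wedge_def vec_eq_iff forall_6 vector_6)
  next
    case False
    then have "a$1 \<noteq> 0 \<or> a$2 \<noteq> 0 \<or> a$3 \<noteq> 0 \<or> a$4 \<noteq> 0 \<or> a$5 \<noteq> 0 \<or> a$6 \<noteq> 0"
      by (auto simp: vec_eq_iff forall_6)
    then show ?thesis using * prods by blast
  qed
qed

theorem sec_pos_iff_pencil:
  assumes "transpose R = R"
  shows "sec_pos R \<longleftrightarrow> (\<exists>x. pos_def (R + x *\<^sub>R hodge))"
proof
  assume sec: "sec_pos R"
  \<comment> \<open>\<open>e12 + e34\<close> and \<open>e12 - e34\<close> are self-dual and
    anti-self-dual, that is eigenvectors of \<open>hodge\<close> for 1 and -1, so they witness its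
    indefiniteness.\<close>
  define v w :: "real^6" where "v = axis 1 1 + axis 6 1" and "w = axis 1 1 - axis 6 1"
  show "\<exists>x. pos_def (R + x *\<^sub>R hodge)"
  proof (rule finsler[OF assms transpose_hodge])
    fix a :: "real^6" assume "a \<noteq> 0" "(hodge *v a) \<bullet> a = 0"
    then obtain X Y where a: "a = wedge X Y"
      using decomposable_if_vol_wedge_zero[of a] by (auto simp: hodge_inner)
    define u where "u = (1 / norm a) *\<^sub>R a"
    have u: "u = wedge ((1 / norm a) *\<^sub>R X) Y"
      unfolding u_def vec_eq_iff forall_6
      by (simp add: a wedge_def vector_6 algebra_simps diff_divide_distrib)
    have "norm u = 1" using \<open>a \<noteq> 0\<close> by (simp add: u_def)
    then have "(R *v u) \<bullet> u > 0" using sec unfolding sec_pos_def u by blast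
    then show "(R *v a) \<bullet> a > 0"
      unfolding u_def quadratic_form_scaleR using \<open>a \<noteq> 0\<close> by (simp add: zero_less_mult_iff)
  next
    show "(hodge *v v) \<bullet> v > 0" "(hodge *v w) \<bullet> w < 0"
      by (simp_all add: hodge_inner vol_wedge_def v_def w_def axis_def)
  qed
next
  assume "\<exists>x. pos_def (R + x *\<^sub>R hodge)"
  then obtain x where x: "pos_def (R + x *\<^sub>R hodge)" ..
  show "sec_pos R"
    unfolding sec_pos_def
  proof (intro allI impI)
    fix X Y assume "norm (wedge X Y) = 1"
    then have "wedge X Y \<noteq> 0" by auto
    then have "((R + x *\<^sub>R hodge) *v wedge X Y) \<bullet> wedge X Y > 0" using x by (simp add: pos_def_def)
    then show "(R *v wedge X Y) \<bullet> wedge X Y > 0"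
      by (simp add: quadratic_form_pencil hodge_inner vol_wedge_decomposable)
  qed
qed

text \<open>The pencil is indefinite far out on both sides, because \<open>hodge\<close> is.\<close>

lemma not_pos_def_pencil:
  "\<exists>b. \<forall>x. \<bar>x\<bar> \<ge> b \<longrightarrow> \<not> pos_def (R + x *\<^sub>R hodge)"
proof -
  define v w :: "real^6" where "v = axis 1 1 + axis 6 1" and "w = axis 1 1 - axis 6 1"
  have hv: "(hodge *v v) \<bullet> v = 2" "(hodge *v w) \<bullet> w = -2"
    by (simp_all add: hodge_inner vol_wedge_def v_def w_def axis_def)
  then have nz: "v \<noteq> 0" "w \<noteq> 0" by auto
  \<comment> \<open>The pencil takes the values \<open>(R *v v) \<bullet> v + 2 * x\<close> and
    \<open>(R *v w) \<bullet> w - 2 * x\<close>; the bound makes one of them nonpositive.\<close>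
  have "\<not> pos_def (R + x *\<^sub>R hodge)" if "\<bar>x\<bar> \<ge> \<bar>(R *v v) \<bullet> v\<bar> + \<bar>(R *v w) \<bullet> w\<bar>" for x
  proof
    assume "pos_def (R + x *\<^sub>R hodge)"
    then have "((R + x *\<^sub>R hodge) *v v) \<bullet> v > 0" "((R + x *\<^sub>R hodge) *v w) \<bullet> w > 0"
      using nz by (auto simp: pos_def_def)
    then show False using that by (auto simp: quadratic_form_pencil hv)
  qed
  then show ?thesis by blast
qed

section \<open>Isolating roots by bisection\<close>

definition roots_of :: "real poly list \<Rightarrow> real set" where
  "roots_of ps = {x. \<exists>p\<in>set ps. poly p x = 0}"

lemma finite_roots_of: "0 \<notin> set ps \<Longrightarrow> finite (roots_of ps)"
proof -
  assume "0 \<notin> set ps"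
  moreover have "roots_of ps = (\<Union>p\<in>set ps. {x. poly p x = 0})" by (auto simp: roots_of_def)
  ultimately show ?thesis by (auto intro!: poly_roots_finite)
qed

lemma card_roots_of: "0 \<notin> set ps \<Longrightarrow> card (roots_of ps) \<le> sum_list (map degree ps)"
proof (induction ps)
  case (Cons p ps)
  have "roots_of (p # ps) = {x. poly p x = 0} \<union> roots_of ps" by (auto simp: roots_of_def)
  then have "card (roots_of (p # ps)) \<le> card {x. poly p x = 0} + card (roots_of ps)"
    by (simp add: card_Un_le)
  also have "\<dots> \<le> degree p + sum_list (map degree ps)"
    using Cons by (intro add_mono card_poly_roots_bound) auto
  finally show ?case by simp
qed (simp add: roots_of_def)

lemma has_root_between_iff:
  assumes "0 \<notin> set ps" "a < b" "a \<notin> roots_of ps" "b \<notin> roots_of ps"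
  shows "has_root_between ps a b \<longleftrightarrow> (\<exists>x\<in>roots_of ps. a < x \<and> x < b)"
proof -
  have "sturm_count p a b > 0 \<longleftrightarrow> (\<exists>x. a < x \<and> x < b \<and> poly p x = 0)" if p: "p \<in> set ps" for p
  proof -
    have "finite {x. a < x \<and> x < b \<and> poly p x = 0}"
      using p assms by (intro finite_subset[OF _ poly_roots_finite[of p]]) auto
    moreover have "poly p a \<noteq> 0" "poly p b \<noteq> 0" using p assms by (auto simp: roots_of_def)
    ultimately show ?thesis using assms by (auto simp: sturm_count_eq_card card_gt_0_iff)
  qed
  then show ?thesis unfolding has_root_between_def roots_of_def by blast
qed

lemma isolated_between_iff:
  assumes "0 \<notin> set ps" "a < b" "a \<notin> roots_of ps" "b \<notin> roots_of ps"
  shows "isolated_between ps a b \<longleftrightarrow>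
    (\<forall>x\<in>roots_of ps. \<forall>y\<in>roots_of ps. a < x \<and> x < b \<and> a < y \<and> y < b \<longrightarrow> x = y)"
proof -
  define S where "S = (\<lambda>p. {x. a < x \<and> x < b \<and> poly p x = 0})"
  have S: "sturm_count p a b = int (card (S p))" "finite (S p)" if "p \<in> set ps" for p
  proof -
    have "poly p a \<noteq> 0" "poly p b \<noteq> 0" using that assms by (auto simp: roots_of_def)
    then show "sturm_count p a b = int (card (S p))"
      using assms by (simp add: sturm_count_eq_card S_def)
    show "finite (S p)" unfolding S_def
      using that assms by (intro finite_subset[OF _ poly_roots_finite[of p]]) auto
  qed
  have gcd: "sturm_count (gcd p q) a b = int (card (S p \<inter> S q))" if "p \<in> set ps" "q \<in> set ps" for p q
  proof -
    have root: "poly (gcd p q) x = 0 \<longleftrightarrow> poly p x = 0 \<and> poly q x = 0" for x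
      by (simp add: poly_eq_0_iff_dvd)
    then have "poly (gcd p q) a \<noteq> 0" "poly (gcd p q) b \<noteq> 0" using that assms by (auto simp: roots_of_def)
    then have "sturm_count (gcd p q) a b = int (card {x. a < x \<and> x < b \<and> poly (gcd p q) x = 0})"
      using assms by (simp add: sturm_count_eq_card)
    also have "{x. a < x \<and> x < b \<and> poly (gcd p q) x = 0} = S p \<inter> S q"
      by (auto simp: root S_def)
    finally show ?thesis .
  qed
  have "isolated_between ps a b \<longleftrightarrow> (\<forall>p\<in>set ps. card (S p) \<le> 1) \<and>
    (\<forall>p\<in>set ps. \<forall>q\<in>set ps. card (S p) = 1 \<and> card (S q) = 1 \<longrightarrow> card (S p \<inter> S q) = 1)"
    unfolding isolated_between_def by (simp add: S(1) gcd)
  also have "\<dots> \<longleftrightarrow> (\<forall>p\<in>set ps. \<forall>q\<in>set ps. \<forall>x\<in>S p. \<forall>y\<in>S q. x = y)"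
  proof
    assume *: "(\<forall>p\<in>set ps. card (S p) \<le> 1) \<and>
      (\<forall>p\<in>set ps. \<forall>q\<in>set ps. card (S p) = 1 \<and> card (S q) = 1 \<longrightarrow> card (S p \<inter> S q) = 1)"
    show "\<forall>p\<in>set ps. \<forall>q\<in>set ps. \<forall>x\<in>S p. \<forall>y\<in>S q. x = y"
    proof (intro ballI)
      fix p q x y assume p: "p \<in> set ps" and q: "q \<in> set ps" and x: "x \<in> S p" and y: "y \<in> S q"
      have "card (S p) > 0" "card (S q) > 0"
        using S(2)[OF p] S(2)[OF q] x y by (auto simp: card_gt_0_iff)
      moreover have "card (S p) \<le> 1" "card (S q) \<le> 1" using * p q by auto
      ultimately have "card (S p) = 1" "card (S q) = 1" by linarith+
      moreover from this have "card (S p \<inter> S q) = 1" using * p q by blast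
      ultimately obtain u v w where "S p = {u}" "S q = {v}" "S p \<inter> S q = {w}"
        by (metis card_1_singletonE)
      with x y show "x = y" by auto
    qed
  next
    assume *: "\<forall>p\<in>set ps. \<forall>q\<in>set ps. \<forall>x\<in>S p. \<forall>y\<in>S q. x = y"
    have "card (S p) \<le> 1" if "p \<in> set ps" for p
      using * that S(2)[OF that] by (simp add: card_le_Suc0_iff_eq)
    moreover have "card (S p \<inter> S q) = 1"
      if "p \<in> set ps" "q \<in> set ps" "card (S p) = 1" "card (S q) = 1" for p q
    proof -
      obtain u v where uv: "S p = {u}" "S q = {v}" using \<open>card (S p) = 1\<close> \<open>card (S q) = 1\<close>
        by (metis card_1_singletonE)
      with * that(1,2) have "u = v" by auto
      with uv show ?thesis by simp
    qed
    ultimately show "(\<forall>p\<in>set ps. card (S p) \<le> 1) \<and>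
      (\<forall>p\<in>set ps. \<forall>q\<in>set ps. card (S p) = 1 \<and> card (S q) = 1 \<longrightarrow> card (S p \<inter> S q) = 1)" by blast
  qed
  also have "\<dots> \<longleftrightarrow> (\<forall>x\<in>roots_of ps. \<forall>y\<in>roots_of ps. a < x \<and> x < b \<and> a < y \<and> y < b \<longrightarrow> x = y)"
    unfolding roots_of_def S_def by blast
  finally show ?thesis .
qed

text \<open>The ratios \<open>(k + 1) / (2 k + 3)\<close> lie between 1/3 and 1/2, so neither part
  exceeds two thirds of the interval; this is the rate behind the power of \<open>3 / 2\<close> in
  \<open>cut_points_isolates\<close>.\<close>

lemma splitting_point_exists:
  assumes "0 \<notin> set ps" "a < b"
  obtains m where "splitting_point ps a b = Some m" "m \<notin> roots_of ps" "a < m" "m < b"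
    "m - a \<le> 2 / 3 * (b - a)" "b - m \<le> 2 / 3 * (b - a)"
proof -
  define f where "f = (\<lambda>k::nat. a + (b - a) * (real k + 1) / (2 * real k + 3))"
  define n where "n = sum_list (map degree ps)"
  have f: "2 * a + b \<le> 3 * f k" "2 * f k \<le> a + b" for k
  proof -
    have "1 / 3 \<le> (real k + 1) / (2 * real k + 3)" "(real k + 1) / (2 * real k + 3) \<le> 1 / 2"
      by (simp_all add: field_simps)
    then have "(b - a) * (1 / 3) \<le> (b - a) * ((real k + 1) / (2 * real k + 3))"
      "(b - a) * ((real k + 1) / (2 * real k + 3)) \<le> (b - a) * (1 / 2)"
      using assms(2) by (intro mult_left_mono; simp)+
    moreover have "f k = a + (b - a) * ((real k + 1) / (2 * real k + 3))" by (simp add: f_def)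
    ultimately show "2 * a + b \<le> 3 * f k" "2 * f k \<le> a + b" by (simp_all add: algebra_simps)
  qed
  have "inj f"
  proof (rule injI)
    fix k l assume "f k = f l"
    then have "(b - a) * ((real k + 1) / (2 * real k + 3)) = (b - a) * ((real l + 1) / (2 * real l + 3))"
      by (simp add: f_def)
    then have "(real k + 1) / (2 * real k + 3) = (real l + 1) / (2 * real l + 3)"
      using assms(2) by (simp only: mult_cancel_left) auto
    then have "(real k + 1) * (2 * real l + 3) = (real l + 1) * (2 * real k + 3)"
      by (subst (asm) frac_eq_eq) auto
    then have "real k = real l" by (simp add: algebra_simps)
    then show "k = l" by simp
  qed
  have split: "splitting_point ps a b = List.find (\<lambda>m. m \<notin> roots_of ps) (map f [0..<Suc n])"
    unfolding splitting_point_def f_def n_def roots_of_def by simp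
  have "splitting_point ps a b \<noteq> None"
  proof
    assume "splitting_point ps a b = None"
    then have "f ` {..<Suc n} \<subseteq> roots_of ps" unfolding split find_None_iff by (auto simp del: upt_Suc)
    then have "card (f ` {..<Suc n}) \<le> card (roots_of ps)"
      by (intro card_mono finite_roots_of assms)
    also have "\<dots> \<le> n" using card_roots_of assms by (simp add: n_def)
    finally show False using \<open>inj f\<close> by (simp add: card_image inj_on_subset)
  qed
  then obtain m where m: "splitting_point ps a b = Some m" by auto
  then obtain k where k: "m = f k" "m \<notin> roots_of ps"
    unfolding split find_Some_iff by (auto simp del: upt_Suc)
  have "a < m" "m < b" "m - a \<le> 2 / 3 * (b - a)" "b - m \<le> 2 / 3 * (b - a)"
    using f[of k] assms(2) unfolding k(1) by (simp_all add: algebra_simps)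
  with that[OF m k(2)] show ?thesis .
qed

text \<open>Generic in the order, because bisection takes place in the reals while the final
  partition lives in \<open>ereal\<close>.\<close>

definition isolates :: "'a::linorder set \<Rightarrow> 'a list \<Rightarrow> bool" where
  "isolates Z = successively (\<lambda>x y. x < y \<and> (\<exists>!z. z \<in> Z \<and> x \<le> z \<and> z \<le> y))"

lemma isolates_append_Cons:
  "isolates Z (xs @ m # ys) \<longleftrightarrow> isolates Z (xs @ [m]) \<and> isolates Z (m # ys)"
  by (auto simp: isolates_def successively_append_iff successively_Cons)

text \<open>Moving an end across a root-free stretch serves twice: when bisection discards a cut
  point, and when the root bound is replaced by infinity.\<close>

lemma isolates_extend_left:
  assumes "isolates Z (m # ys)" "ys \<noteq> []" "a < m" "\<And>z. z \<in> Z \<Longrightarrow> a \<le> z \<Longrightarrow> m < z"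
  shows "isolates Z (a # ys)"
proof -
  have "(z \<in> Z \<and> a \<le> z \<and> z \<le> hd ys) \<longleftrightarrow> (z \<in> Z \<and> m \<le> z \<and> z \<le> hd ys)" for z
    using assms(3) assms(4)[of z] by auto
  then show ?thesis using assms(1-3) by (auto simp: isolates_def successively_Cons)
qed

lemma isolates_extend_right:
  assumes "isolates Z (xs @ [m])" "xs \<noteq> []" "m < b" "\<And>z. z \<in> Z \<Longrightarrow> z \<le> b \<Longrightarrow> z < m"
  shows "isolates Z (xs @ [b])"
proof -
  have "(z \<in> Z \<and> last xs \<le> z \<and> z \<le> b) \<longleftrightarrow> (z \<in> Z \<and> last xs \<le> z \<and> z \<le> m)" for z
    using assms(3) assms(4)[of z] by auto
  then show ?thesis using assms(1-3) by (auto simp: isolates_def successively_append_iff)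
qed

lemma isolates_nth:
  assumes "isolates Z as" "Suc j < length as"
  shows "as ! j < as ! Suc j \<and> (\<exists>!z. z \<in> Z \<and> as ! j \<le> z \<and> z \<le> as ! Suc j)"
  using assms
proof (induction as arbitrary: j)
  case (Cons a as)
  then show ?case
    by (cases j; cases as) (auto simp: isolates_def)
qed simp

lemma isolates_sorted: "isolates Z as \<Longrightarrow> sorted_wrt (<) as"
  unfolding isolates_def
  by (subst successively_conv_sorted_wrt[symmetric]) (auto intro: successively_mono)

lemma cut_points_isolated:
  assumes ps: "0 \<notin> set ps" and ab: "a < b" "a \<notin> roots_of ps" "b \<notin> roots_of ps"
    and iso: "isolated_between ps a b"
  shows "\<exists>xs. cut_points ps a b = Some xs \<and> set xs \<inter> roots_of ps = {} \<and>
    ((\<exists>x\<in>roots_of ps. a < x \<and> x < b) \<longrightarrow> isolates (roots_of ps) (a # xs @ [b])) \<and>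
    ((\<forall>x\<in>roots_of ps. \<not> (a < x \<and> x < b)) \<longrightarrow> xs = [])"
proof -
  have uniq: "x = y" if "x \<in> roots_of ps" "y \<in> roots_of ps" "a \<le> x" "x \<le> b" "a \<le> y" "y \<le> b" for x y
  proof -
    have "a < x" "x < b" "a < y" "y < b" using that ab by (auto simp: less_le)
    with that iso show ?thesis unfolding isolated_between_iff[OF ps ab] by blast
  qed
  have "cut_points ps a b = Some []" using iso by (simp add: cut_points.simps)
  moreover have "isolates (roots_of ps) [a, b]" if "x \<in> roots_of ps" "a < x" "x < b" for x
    using ab(1) that uniq by (auto simp: isolates_def intro!: ex1I[of _ x])
  ultimately show ?thesis by auto
qed

text \<open>Induction on the number of cuts that bring the length below the root separation
  \<open>d\<close>, where two roots no longer fit. Termination and correctness come together, the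
  result being \<open>Some\<close>. An interval without roots is treated apart, as it ends the
  bisection at once but cannot satisfy \<open>isolates\<close>.\<close>

lemma cut_points_isolates:
  assumes ps: "0 \<notin> set ps"
    and sep: "\<And>x y. x \<in> roots_of ps \<Longrightarrow> y \<in> roots_of ps \<Longrightarrow> x \<noteq> y \<Longrightarrow> d \<le> \<bar>x - y\<bar>"
    and "a < b" "a \<notin> roots_of ps" "b \<notin> roots_of ps" "b - a < (3 / 2) ^ n * d"
  shows "\<exists>xs. cut_points ps a b = Some xs \<and> set xs \<inter> roots_of ps = {} \<and>
    ((\<exists>x\<in>roots_of ps. a < x \<and> x < b) \<longrightarrow> isolates (roots_of ps) (a # xs @ [b])) \<and>
    ((\<forall>x\<in>roots_of ps. \<not> (a < x \<and> x < b)) \<longrightarrow> xs = [])"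
  using assms(3-)
proof (induction n arbitrary: a b)
  case 0
  have "isolated_between ps a b"
    unfolding isolated_between_iff[OF ps 0(1-3)] using sep 0(4) by fastforce
  with 0 show ?case by (intro cut_points_isolated[OF ps])
next
  case (Suc n)
  show ?case
  proof (cases "isolated_between ps a b")
    case True
    with Suc.prems show ?thesis by (intro cut_points_isolated[OF ps])
  next
    case False
    obtain m where m: "splitting_point ps a b = Some m" "m \<notin> roots_of ps" "a < m" "m < b"
      "m - a \<le> 2 / 3 * (b - a)" "b - m \<le> 2 / 3 * (b - a)"
      using splitting_point_exists[OF ps \<open>a < b\<close>] .
    \<comment> \<open>Failure of isolation means at least two roots, so a part that is kept alone
      still contains one and its cut points isolate.\<close>
    have root: "\<exists>x\<in>roots_of ps. a < x \<and> x < b"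
      using False unfolding isolated_between_iff[OF ps Suc.prems(1-3)] by blast
    have small: "m - a < (3 / 2) ^ n * d" "b - m < (3 / 2) ^ n * d"
      using m(5,6) Suc.prems(4) by simp_all
    obtain xs where xs: "cut_points ps a m = Some xs" "set xs \<inter> roots_of ps = {}"
      "(\<exists>x\<in>roots_of ps. a < x \<and> x < m) \<Longrightarrow> isolates (roots_of ps) (a # xs @ [m])"
      using Suc.IH[OF m(3) Suc.prems(2) m(2) small(1)] by blast
    obtain ys where ys: "cut_points ps m b = Some ys" "set ys \<inter> roots_of ps = {}"
      "(\<exists>x\<in>roots_of ps. m < x \<and> x < b) \<Longrightarrow> isolates (roots_of ps) (m # ys @ [b])"
      using Suc.IH[OF m(4) m(2) Suc.prems(3) small(2)] by blast
    note left = has_root_between_iff[OF ps m(3) Suc.prems(2) m(2)]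
    note right = has_root_between_iff[OF ps m(4) m(2) Suc.prems(3)]
    consider "\<not> has_root_between ps a m" | "has_root_between ps a m" "\<not> has_root_between ps m b"
      | "has_root_between ps a m" "has_root_between ps m b" by blast
    then have "\<exists>zs. cut_points ps a b = Some zs \<and> set zs \<inter> roots_of ps = {} \<and>
      isolates (roots_of ps) (a # zs @ [b])"
    proof cases
      case 1
      have none: "m < z" if "z \<in> roots_of ps" "a \<le> z" for z
      proof -
        have "a \<noteq> z" "m \<noteq> z" using that m Suc.prems by auto
        with 1 that show ?thesis unfolding left by force
      qed
      then have "\<exists>x\<in>roots_of ps. m < x \<and> x < b" using root by force
      then have "isolates (roots_of ps) (a # ys @ [b])"
        using isolates_extend_left[OF ys(3)] none m(3) by simp
      moreover have "cut_points ps a b = Some ys"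
        using False 1 by (subst cut_points.simps) (simp add: m(1) ys(1))
      ultimately show ?thesis using ys(2) by blast
    next
      case 2
      have none: "z < m" if "z \<in> roots_of ps" "z \<le> b" for z
      proof -
        have "b \<noteq> z" "m \<noteq> z" using that m Suc.prems by auto
        with 2(2) that show ?thesis unfolding right by force
      qed
      have "isolates (roots_of ps) ((a # xs) @ [m])" using xs(3) 2(1) left by simp
      then have "isolates (roots_of ps) ((a # xs) @ [b])"
        by (rule isolates_extend_right) (use none m(4) in auto)
      moreover have "cut_points ps a b = Some xs"
        using False 2 by (subst cut_points.simps) (simp add: m(1) xs(1))
      ultimately show ?thesis using xs(2) by auto
    next
      case 3
      have "isolates (roots_of ps) ((a # xs) @ m # (ys @ [b]))"
        using xs(3) ys(3) 3 left right by (subst isolates_append_Cons) simp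
      moreover have "cut_points ps a b = Some (xs @ m # ys)"
        using False 3 by (subst cut_points.simps) (simp add: m(1) xs(1) ys(1))
      ultimately show ?thesis using xs(2) ys(2) m(2) by auto
    qed
    with root show ?thesis by blast
  qed
qed

section \<open>Root bound, root separation and the complete partition\<close>

lemma member_le_sum_list_real:
  fixes f :: "'a \<Rightarrow> real"
  assumes "x \<in> set xs" "\<And>y. f y \<ge> 0"
  shows "f x \<le> (\<Sum>y\<leftarrow>xs. f y)"
  using assms(1)
proof (induction xs)
  case (Cons y ys)
  have "(\<Sum>y\<leftarrow>ys. f y) \<ge> 0" using assms(2) by (intro sum_list_nonneg) auto
  with Cons assms(2)[of y] show ?case by auto
qed simp

text \<open>For \<open>\<bar>z\<bar> > 1\<close>, solve the equation for the leading term and bound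
  every lower power by the one of exponent \<open>degree p - 1\<close>. The summand for
  \<open>i = degree p\<close> is 1 and covers \<open>\<bar>z\<bar> \<le> 1\<close>.\<close>

lemma cauchy_root_bound:
  fixes p :: "real poly"
  assumes "p \<noteq> 0" "poly p z = 0"
  shows "\<bar>z\<bar> \<le> (\<Sum>i\<le>degree p. \<bar>coeff p i\<bar> / \<bar>lead_coeff p\<bar>)"
proof -
  define n where "n = degree p"
  define c where "c = (\<lambda>i. \<bar>coeff p i\<bar> / \<bar>lead_coeff p\<bar>)"
  have lc: "lead_coeff p \<noteq> 0" using assms by simp
  have "n \<noteq> 0"
  proof
    assume "n = 0"
    then obtain a where "p = [:a:]" unfolding n_def by (rule degree_eq_zeroE)
    with assms show False by simp
  qed
  then obtain k where k: "n = Suc k" using not0_implies_Suc by blast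
  have cn: "c n = 1" using lc by (simp add: c_def n_def)
  have c: "c i \<ge> 0" for i by (simp add: c_def)
  have sum: "(\<Sum>i\<le>n. c i) = (\<Sum>i\<le>k. c i) + 1" by (simp add: k cn[unfolded k])
  have "\<bar>z\<bar> \<le> (\<Sum>i\<le>n. c i)"
  proof (cases "\<bar>z\<bar> \<le> 1")
    case True
    then show ?thesis using sum_nonneg[of "{..k}" c] c sum by simp
  next
    case False
    have "(\<Sum>i\<le>k. coeff p i * z ^ i) + lead_coeff p * z ^ n = 0"
      using assms(2) by (simp add: poly_altdef n_def[symmetric] k)
    then have "lead_coeff p * z ^ n = - (\<Sum>i\<le>k. coeff p i * z ^ i)" by simp
    then have "\<bar>lead_coeff p\<bar> * \<bar>z\<bar> ^ n = \<bar>\<Sum>i\<le>k. coeff p i * z ^ i\<bar>"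
      by (metis abs_minus_cancel abs_mult power_abs)
    also have "\<dots> \<le> (\<Sum>i\<le>k. \<bar>coeff p i * z ^ i\<bar>)" by (rule sum_abs)
    also have "\<dots> \<le> (\<Sum>i\<le>k. \<bar>lead_coeff p\<bar> * c i * \<bar>z\<bar> ^ k)"
    proof (rule sum_mono)
      fix i assume "i \<in> {..k}"
      then have "\<bar>z\<bar> ^ i \<le> \<bar>z\<bar> ^ k" using False by (intro power_increasing) auto
      then have "\<bar>coeff p i\<bar> * \<bar>z\<bar> ^ i \<le> \<bar>coeff p i\<bar> * \<bar>z\<bar> ^ k" by (intro mult_left_mono) auto
      then show "\<bar>coeff p i * z ^ i\<bar> \<le> \<bar>lead_coeff p\<bar> * c i * \<bar>z\<bar> ^ k"
        using lc by (simp add: c_def abs_mult power_abs)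
    qed
    also have "\<dots> = (\<bar>lead_coeff p\<bar> * \<bar>z\<bar> ^ k) * (\<Sum>i\<le>k. c i)"
      by (simp add: sum_distrib_left sum_distrib_right algebra_simps)
    finally have "(\<bar>lead_coeff p\<bar> * \<bar>z\<bar> ^ k) * \<bar>z\<bar> \<le> (\<bar>lead_coeff p\<bar> * \<bar>z\<bar> ^ k) * (\<Sum>i\<le>k. c i)"
      by (simp add: k algebra_simps)
    moreover have "\<bar>lead_coeff p\<bar> * \<bar>z\<bar> ^ k > 0" using lc False by (intro mult_pos_pos zero_less_power) auto
    ultimately have "\<bar>z\<bar> \<le> (\<Sum>i\<le>k. c i)" by (simp only: mult_le_cancel_left_pos)
    then show ?thesis using sum by simp
  qed
  then show ?thesis by (simp add: c_def n_def)
qed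

lemma root_bound_pos: "root_bound ps > 0"
  unfolding root_bound_def
  by (intro add_pos_nonneg sum_list_nonneg) (auto intro!: sum_nonneg)

lemma roots_of_less_root_bound:
  assumes "0 \<notin> set ps" "z \<in> roots_of ps"
  shows "\<bar>z\<bar> < root_bound ps"
proof -
  obtain p where p: "p \<in> set ps" "poly p z = 0" using assms(2) by (auto simp: roots_of_def)
  with assms have "p \<noteq> 0" by auto
  have "\<bar>z\<bar> \<le> (\<Sum>i\<le>degree p. \<bar>coeff p i\<bar> / \<bar>lead_coeff p\<bar>)"
    using \<open>p \<noteq> 0\<close> p(2) by (rule cauchy_root_bound)
  also have "\<dots> \<le> (\<Sum>p\<leftarrow>ps. \<Sum>i\<le>degree p. \<bar>coeff p i\<bar> / \<bar>lead_coeff p\<bar>)"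
    using p(1) by (rule member_le_sum_list_real[where f = "\<lambda>p. \<Sum>i\<le>degree p. \<bar>coeff p i\<bar> / \<bar>lead_coeff p\<bar>"])
      (auto intro!: sum_nonneg)
  finally show ?thesis by (simp add: root_bound_def)
qed

lemma finite_separated:
  fixes Z :: "real set"
  assumes "finite Z"
  obtains d where "d > 0" "\<And>x y. x \<in> Z \<Longrightarrow> y \<in> Z \<Longrightarrow> x \<noteq> y \<Longrightarrow> d \<le> \<bar>x - y\<bar>"
proof
  \<comment> \<open>The extra 1 keeps the minimum defined when there are fewer than two
    points.\<close>
  define D where "D = insert 1 ((\<lambda>(x, y). \<bar>x - y\<bar>) ` {(x, y) \<in> Z \<times> Z. x \<noteq> y})"
  have "finite {(x, y) \<in> Z \<times> Z. x \<noteq> y}"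
    by (rule finite_subset[of _ "Z \<times> Z"]) (use assms in auto)
  then have D: "finite D" by (simp add: D_def)
  have "D \<noteq> {}" by (simp add: D_def)
  then show "Min D > 0" using D by (subst Min_gr_iff) (auto simp: D_def)
  fix x y assume "x \<in> Z" "y \<in> Z" "x \<noteq> y"
  then have "\<bar>x - y\<bar> \<in> D" by (auto simp: D_def)
  then show "Min D \<le> \<bar>x - y\<bar>" using D by simp
qed

lemma sturm_partition_isolates:
  assumes ps: "0 \<notin> set ps"
  shows "\<exists>xs. sturm_partition ps = Some (-\<infinity> # map ereal xs @ [\<infinity>]) \<and> set xs \<inter> roots_of ps = {} \<and>
    (if roots_of ps = {} then xs = [] else isolates (ereal ` roots_of ps) (-\<infinity> # map ereal xs @ [\<infinity>]))"
proof -
  define B where "B = root_bound ps"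
  have bound: "- B < z" "z < B" if "z \<in> roots_of ps" for z
    using roots_of_less_root_bound[OF ps that] by (auto simp: B_def)
  have B: "- B < B" "- B \<notin> roots_of ps" "B \<notin> roots_of ps"
    using root_bound_pos[of ps] bound by (auto simp: B_def)
  obtain d where d: "d > 0" "\<And>x y. x \<in> roots_of ps \<Longrightarrow> y \<in> roots_of ps \<Longrightarrow> x \<noteq> y \<Longrightarrow> d \<le> \<bar>x - y\<bar>"
    using finite_separated[OF finite_roots_of[OF ps]] by blast
  obtain n where "(B - - B) / d < (3 / 2) ^ n" using real_arch_pow[of "3 / 2"] by auto
  then have n: "B - - B < (3 / 2) ^ n * d" using d(1) by (simp add: pos_divide_less_eq)
  obtain xs where xs: "cut_points ps (- B) B = Some xs" "set xs \<inter> roots_of ps = {}"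
    "(\<exists>x\<in>roots_of ps. - B < x \<and> x < B) \<Longrightarrow> isolates (roots_of ps) (- B # xs @ [B])"
    "(\<forall>x\<in>roots_of ps. \<not> (- B < x \<and> x < B)) \<Longrightarrow> xs = []"
    using cut_points_isolates[OF ps d(2) B n] by blast
  have "isolates (ereal ` roots_of ps) (-\<infinity> # map ereal xs @ [\<infinity>])" if "roots_of ps \<noteq> {}"
  proof -
    have "isolates (roots_of ps) (- B # xs @ [B])" using xs(3) bound that by blast
    then have "isolates (ereal ` roots_of ps) (map ereal (- B # xs @ [B]))"
      unfolding isolates_def successively_map
      by (rule successively_mono) (auto intro!: image_eqI)
    then have "isolates (ereal ` roots_of ps) (ereal (- B) # (map ereal xs @ [ereal B]))" by simp
    \<comment> \<open>All roots lie strictly inside the root bound, so the stretches out to infinity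
      are root-free.\<close>
    then have "isolates (ereal ` roots_of ps) ((-\<infinity> # map ereal xs) @ [ereal B])"
      unfolding append_Cons by (rule isolates_extend_left) (use bound in auto)
    then show ?thesis
      unfolding append_Cons[symmetric] by (rule isolates_extend_right) (use bound in auto)
  qed
  moreover have "sturm_partition ps = Some (-\<infinity> # map ereal xs @ [\<infinity>])"
    using xs(1) by (simp add: sturm_partition_def B_def)
  moreover have "xs = []" if "roots_of ps = {}" using xs(4) that by simp
  ultimately show ?thesis using xs(2) by auto
qed

section \<open>Common root-isolating partitions\<close>

lemma filterlim_poly_at_top:
  fixes p :: "real poly"
  assumes "degree p > 0" "lead_coeff p > 0"
  shows "filterlim (poly p) at_top at_top"
  using assms
proof (induction p)
  case (pCons a q)
  have "q \<noteq> 0" using pCons.prems(1) by auto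
  then have lc: "lead_coeff q > 0" using pCons.prems(2) by simp
  have "filterlim (\<lambda>x. poly q x * x) at_top at_top"
  proof (cases "degree q = 0")
    case True
    then obtain c where "q = [:c:]" by (rule degree_eq_zeroE)
    with lc show ?thesis
      by (simp add: filterlim_tendsto_pos_mult_at_top[OF tendsto_const _ filterlim_ident])
  next
    case False
    then show ?thesis
      using pCons.IH lc by (intro filterlim_at_top_mult_at_top filterlim_ident) auto
  qed
  then have "filterlim (\<lambda>x. a + poly q x * x) at_top at_top"
    by (intro filterlim_tendsto_add_at_top[OF tendsto_const])
  then show ?case by (simp add: mult.commute)
qed simp

text \<open>\<open>Lim\<close> in \<open>poly_at\<close> carries information only where a limit
  exists. A nonconstant polynomial tends to plus or minus infinity, so only the zero polynomial can
  have limit 0.\<close>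

lemma poly_limit_at_top:
  "\<exists>L. ((\<lambda>x. ereal (poly p x)) \<longlongrightarrow> L) at_top \<and> (p \<noteq> 0 \<longrightarrow> L \<noteq> 0)"
proof (cases "degree p = 0")
  case True
  then obtain c where "p = [:c:]" by (rule degree_eq_zeroE)
  then show ?thesis by (intro exI[of _ "ereal c"]) (auto simp: zero_ereal_def)
next
  case deg: False
  then have "lead_coeff p \<noteq> 0" by auto
  then consider "lead_coeff p > 0" | "lead_coeff (- p) > 0" by fastforce
  then show ?thesis
  proof cases
    case 1
    then have "((\<lambda>x. ereal (poly p x)) \<longlongrightarrow> \<infinity>) at_top"
      using deg filterlim_poly_at_top by (simp add: tendsto_PInfty_eq_at_top)
    then show ?thesis by force
  next
    case 2
    then have lim: "((\<lambda>x. ereal (poly (- p) x)) \<longlongrightarrow> \<infinity>) at_top"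
      unfolding tendsto_PInfty_eq_at_top by (intro filterlim_poly_at_top) (use deg in auto)
    have "((\<lambda>x. ereal (poly p x)) \<longlongrightarrow> -\<infinity>) at_top"
      using tendsto_uminus_ereal[OF lim] by simp
    then show ?thesis by force
  qed
qed

lemma poly_limit_at_bot:
  "\<exists>L. ((\<lambda>x. ereal (poly p x)) \<longlongrightarrow> L) at_bot \<and> (p \<noteq> 0 \<longrightarrow> L \<noteq> 0)"
proof -
  have "pcompose p [:0, -1:] \<noteq> 0" if "p \<noteq> 0"
    using that by (simp add: pcompose_eq_0_iff)
  then show ?thesis
    using poly_limit_at_top[of "pcompose p [:0, -1:]"]
    by (auto simp: filterlim_at_bot_mirror poly_pcompose)
qed

lemma poly_at_nonzero:
  assumes "p \<noteq> 0" "\<And>r. a = ereal r \<Longrightarrow> poly p r \<noteq> 0"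
  shows "poly_at p a \<noteq> 0"
proof (cases a)
  case (real r)
  then show ?thesis using assms(2) by (simp add: poly_at_def zero_ereal_def)
next
  case PInf
  obtain L where L: "((\<lambda>x. ereal (poly p x)) \<longlongrightarrow> L) at_top" "L \<noteq> 0"
    using poly_limit_at_top assms(1) by blast
  with PInf show ?thesis
    using tendsto_Lim[OF trivial_limit_at_top_linorder L(1)] by (simp add: poly_at_def)
next
  case MInf
  obtain L where L: "((\<lambda>x. ereal (poly p x)) \<longlongrightarrow> L) at_bot" "L \<noteq> 0"
    using poly_limit_at_bot assms(1) by blast
  with MInf show ?thesis
    using tendsto_Lim[OF trivial_limit_at_bot_linorder L(1)] by (simp add: poly_at_def)
qed

text \<open>An infinite partition point may be the witness for TRUE: finitely many positive limits
  are attained with positive values at one common finite parameter.\<close>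

lemma poly_at_all_pos:
  assumes "finite I" "\<forall>i\<in>I. poly_at (f i) a > 0"
  shows "\<exists>x. \<forall>i\<in>I. poly (f i) x > 0"
proof -
  have ev: "\<exists>x. \<forall>i\<in>I. poly (f i) x > 0"
    if F: "F \<noteq> bot" and pos: "\<And>i. i \<in> I \<Longrightarrow> Lim F (\<lambda>x. ereal (poly (f i) x)) > 0"
      and lim: "\<And>i. \<exists>L. ((\<lambda>x. ereal (poly (f i) x)) \<longlongrightarrow> L) F" for F :: "real filter"
  proof -
    have "eventually (\<lambda>x. poly (f i) x > 0) F" if "i \<in> I" for i
    proof -
      obtain L where L: "((\<lambda>x. ereal (poly (f i) x)) \<longlongrightarrow> L) F" using lim by blast
      then have "L > 0" using pos[OF that] tendsto_Lim[OF F L] by simp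
      from order_tendstoD(1)[OF L this] show ?thesis by simp
    qed
    then have "eventually (\<lambda>x. \<forall>i\<in>I. poly (f i) x > 0) F"
      using assms(1) by (auto intro: eventually_ball_finite)
    then show ?thesis by (rule eventually_happens'[OF F])
  qed
  show ?thesis
  proof (cases a)
    case (real r)
    with assms(2) show ?thesis by (auto simp: poly_at_def)
  next
    case PInf
    then show ?thesis
      using assms(2) poly_limit_at_top by (intro ev[of at_top]) (auto simp: poly_at_def)
  next
    case MInf
    then show ?thesis
      using assms(2) poly_limit_at_bot by (intro ev[of at_bot]) (auto simp: poly_at_def)
  qed
qed

theorem sturm_partition_correct:
  assumes ps: "0 \<notin> set ps"
  shows "\<exists>as. sturm_partition ps = Some as \<and> common_root_isolating_partition ps as"
proof -
  obtain xs where xs: "sturm_partition ps = Some (-\<infinity> # map ereal xs @ [\<infinity>])" "set xs \<inter> roots_of ps = {}"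
    "if roots_of ps = {} then xs = [] else isolates (ereal ` roots_of ps) (-\<infinity> # map ereal xs @ [\<infinity>])"
    using sturm_partition_isolates[OF ps] by blast
  define as where "as = -\<infinity> # map ereal xs @ [\<infinity>]"
  have "poly_at p a \<noteq> 0" if "p \<in> set ps" "a \<in> set as" for p a
    using that ps xs(2) by (intro poly_at_nonzero) (auto simp: as_def roots_of_def)
  moreover have "sorted_wrt (<) as"
  proof (cases "roots_of ps = {}")
    case True
    then show ?thesis using xs(3) by (simp add: as_def)
  next
    case False
    then show ?thesis using xs(3) isolates_sorted by (simp only: as_def if_False)
  qed
  moreover have "(\<forall>j. Suc j < length as \<longrightarrow>
          (\<exists>p\<in>set ps. \<exists>!x. poly p x = 0 \<and> as ! j \<le> ereal x \<and> ereal x \<le> as ! Suc j) \<and>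
          (\<forall>p\<in>set ps. \<forall>q\<in>set ps. \<forall>x y.
              poly p x = 0 \<and> as ! j \<le> ereal x \<and> ereal x \<le> as ! Suc j \<and>
              poly q y = 0 \<and> as ! j \<le> ereal y \<and> ereal y \<le> as ! Suc j \<longrightarrow> x = y)) \<or>
      ((\<forall>p\<in>set ps. \<forall>x. poly p x \<noteq> 0) \<and> length as = 2)"
  proof (cases "roots_of ps = {}")
    case True
    then show ?thesis using xs(3) by (auto simp: as_def roots_of_def)
  next
    case False
    then have iso: "isolates (ereal ` roots_of ps) as" using xs(3) by (simp add: as_def)
    show ?thesis
    proof (rule disjI1, intro allI impI)
      fix j assume "Suc j < length as"
      then have "\<exists>!e. e \<in> ereal ` roots_of ps \<and> as ! j \<le> e \<and> e \<le> as ! Suc j"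
        using isolates_nth[OF iso] by simp
      then obtain e where e: "e \<in> ereal ` roots_of ps" "as ! j \<le> e" "e \<le> as ! Suc j"
        and uniq: "\<And>z. z \<in> ereal ` roots_of ps \<Longrightarrow> as ! j \<le> z \<Longrightarrow> z \<le> as ! Suc j \<Longrightarrow> z = e"
        by (elim ex1E) blast
      obtain x where x: "x \<in> roots_of ps" "e = ereal x" using e(1) by auto
      have uniq': "y = x" if "q \<in> set ps" "poly q y = 0" "as ! j \<le> ereal y" "ereal y \<le> as ! Suc j" for q y
        using uniq[of "ereal y"] that by (auto simp: roots_of_def x(2))
      obtain p where p: "p \<in> set ps" "poly p x = 0" using x(1) by (auto simp: roots_of_def)
      have "\<exists>!y. poly p y = 0 \<and> as ! j \<le> ereal y \<and> ereal y \<le> as ! Suc j"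
      proof (rule ex1I)
        show "poly p x = 0 \<and> as ! j \<le> ereal x \<and> ereal x \<le> as ! Suc j" using p e(2,3) x(2) by simp
      qed (use p(1) uniq' in blast)
      then show "(\<exists>p\<in>set ps. \<exists>!x. poly p x = 0 \<and> as ! j \<le> ereal x \<and> ereal x \<le> as ! Suc j) \<and>
          (\<forall>p\<in>set ps. \<forall>q\<in>set ps. \<forall>x y.
              poly p x = 0 \<and> as ! j \<le> ereal x \<and> ereal x \<le> as ! Suc j \<and>
              poly q y = 0 \<and> as ! j \<le> ereal y \<and> ereal y \<le> as ! Suc j \<longrightarrow> x = y)"
        using p(1) uniq' by blast
    qed
  qed
  moreover have "2 \<le> length as" "hd as = -\<infinity>" "last as = \<infinity>" by (auto simp: as_def)
  ultimately have "common_root_isolating_partition ps as"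
    unfolding common_root_isolating_partition_def by blast
  with xs(1) show ?thesis by (auto simp: as_def)
qed

text \<open>The first partition point at or beyond \<open>c\<close> comes before \<open>d\<close>,
  since otherwise one interval would contain both roots. It differs from \<open>c\<close> because
  partition points are not roots.\<close>

lemma partition_separates_roots:
  assumes part: "common_root_isolating_partition ps as"
    and c: "c \<in> roots_of ps" and d: "d \<in> roots_of ps" and "c < d"
  shows "\<exists>r. ereal r \<in> set as \<and> c < r \<and> r < d"
proof -
  have len: "2 \<le> length as" and hd: "hd as = -\<infinity>" and last: "last as = \<infinity>"
    and nz: "\<And>p a. p \<in> set ps \<Longrightarrow> a \<in> set as \<Longrightarrow> poly_at p a \<noteq> 0"
    using part unfolding common_root_isolating_partition_def by auto
  \<comment> \<open>The root \<open>c\<close> rules out the alternative of a collection without real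
    roots.\<close>
  have uniq: "x = y" if "Suc j < length as" "x \<in> roots_of ps" "y \<in> roots_of ps"
    "as ! j \<le> ereal x" "ereal x \<le> as ! Suc j" "as ! j \<le> ereal y" "ereal y \<le> as ! Suc j" for j x y
    using part that c unfolding common_root_isolating_partition_def roots_of_def by blast
  have "as \<noteq> []" using len by auto
  then have "as ! (length as - 1) = \<infinity>" "as ! 0 = -\<infinity>"
    using hd last by (simp_all add: last_conv_nth hd_conv_nth)
  then have "\<exists>j<length as - 1. (\<forall>i\<le>j. \<not> ereal c \<le> as ! i) \<and> ereal c \<le> as ! Suc j"
    by (intro ex_least_nat_less) auto
  then obtain j where j: "j < length as - 1" "as ! j \<le> ereal c" "ereal c \<le> as ! Suc j"
    by (auto simp: not_le less_imp_le)
  then have j': "Suc j < length as" by simp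
  have "as ! Suc j < ereal d"
  proof (rule ccontr)
    assume "\<not> as ! Suc j < ereal d"
    then have "as ! j \<le> ereal d" "ereal d \<le> as ! Suc j"
      using j(2) \<open>c < d\<close> by (auto simp: not_less intro: order_trans[of _ "ereal c"])
    then show False using uniq[OF j' c d j(2,3)] \<open>c < d\<close> by simp
  qed
  then obtain r where r: "as ! Suc j = ereal r" using j(3) by (cases "as ! Suc j") auto
  have mem: "ereal r \<in> set as" using j' r by (metis nth_mem)
  have "c \<noteq> r"
  proof
    assume "c = r"
    obtain p where "p \<in> set ps" "poly p c = 0" using c by (auto simp: roots_of_def)
    then show False using nz[OF _ mem] \<open>c = r\<close> by (auto simp: poly_at_def zero_ereal_def)
  qed
  then show ?thesis using mem j(3) r \<open>as ! Suc j < ereal d\<close> by auto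
qed

lemma set_nonzero_sigmas: "set (nonzero_sigmas R) = {sigma R i |i. i \<in> {1..6} \<and> sigma R i \<noteq> 0}"
  by (auto simp: nonzero_sigmas_def)

text \<open>The set of good parameters is bounded, so it is surrounded by two roots \<open>c < d\<close> without a root in
  between; a partition point between them has the same signs.\<close>

theorem verdict_correct:
  assumes R: "transpose R = R" and part: "common_root_isolating_partition (nonzero_sigmas R) as"
  shows "verdict R as \<longleftrightarrow> sec_pos R"
proof
  assume "verdict R as"
  then obtain a where "\<forall>i\<in>{1..6}. poly_at (sigma R i) a > 0" unfolding verdict_def by blast
  then obtain x where "\<forall>i\<in>{1..6}. poly (sigma R i) x > 0"
    using poly_at_all_pos[of "{1..6}" "sigma R" a] by blast
  then show "sec_pos R"
    unfolding sec_pos_iff_pencil[OF R] using pos_def_pencil_iff[OF transpose_pencil[OF R]] by blast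
next
  assume "sec_pos R"
  then obtain x where "pos_def (R + x *\<^sub>R hodge)" using sec_pos_iff_pencil[OF R] by blast
  then have x: "\<forall>i\<in>{1..6}. poly (sigma R i) x > 0"
    using pos_def_pencil_iff[OF transpose_pencil[OF R]] by blast
  define Z where "Z = roots_of (nonzero_sigmas R)"
  \<comment> \<open>Positivity at \<open>x\<close> shows that no \<open>sigma R i\<close> is the
    zero polynomial, so the partition isolates the roots of all six.\<close>
  have sigmas: "set (nonzero_sigmas R) = sigma R ` {1..6}"
    using x unfolding set_nonzero_sigmas by force
  have Z: "z \<in> Z" if "i \<in> {1..6}" "poly (sigma R i) z = 0" for i z
    using that by (auto simp: Z_def roots_of_def sigmas)
  have "finite Z"
    unfolding Z_def by (rule finite_roots_of) (simp add: nonzero_sigmas_def)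
  obtain b where b: "\<And>y. \<bar>y\<bar> \<ge> b \<Longrightarrow> \<not> pos_def (R + y *\<^sub>R hodge)"
    using not_pos_def_pencil by blast
  have bad: "\<exists>i\<in>{1..6}. poly (sigma R i) y \<le> 0" if "\<bar>y\<bar> \<ge> b" for y
    using b[OF that] pos_def_pencil_iff[OF transpose_pencil[OF R]] by (meson not_le)
  define C D where "C = {z\<in>Z. z < x}" and "D = {z\<in>Z. x < z}"
  have fin: "finite C" "finite D" using \<open>finite Z\<close> by (auto simp: C_def D_def)
  have "C \<noteq> {}"
  proof -
    \<comment> \<open>A point to the left of \<open>x\<close> and beyond the bound \<open>b\<close>:
      some \<open>sigma R i\<close> is nonpositive there and hence has a root between
      \<open>y\<close> and \<open>x\<close>, possibly \<open>y\<close> itself.\<close>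
    define y where "y = - \<bar>x\<bar> - \<bar>b\<bar> - 1"
    have y: "y < x" "\<bar>y\<bar> \<ge> b" by (auto simp: y_def)
    then obtain i where i: "i \<in> {1..6}" "poly (sigma R i) y \<le> 0" using bad by blast
    have "\<exists>z. y \<le> z \<and> z < x \<and> poly (sigma R i) z = 0"
    proof (cases "poly (sigma R i) y = 0")
      case False
      then have "poly (sigma R i) y < 0" "poly (sigma R i) x > 0" using i x by auto
      from poly_IVT_pos[OF y(1) this] show ?thesis by (meson less_imp_le)
    qed (use y(1) in blast)
    with Z[OF i(1)] show ?thesis by (auto simp: C_def)
  qed
  have "D \<noteq> {}"
  proof -
    define y where "y = \<bar>x\<bar> + \<bar>b\<bar> + 1"
    have y: "x < y" "\<bar>y\<bar> \<ge> b" by (auto simp: y_def)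
    then obtain i where i: "i \<in> {1..6}" "poly (sigma R i) y \<le> 0" using bad by blast
    have "\<exists>z. x < z \<and> z \<le> y \<and> poly (sigma R i) z = 0"
    proof (cases "poly (sigma R i) y = 0")
      case False
      then have "poly (sigma R i) x > 0" "poly (sigma R i) y < 0" using i x by auto
      from poly_IVT_neg[OF y(1) this] show ?thesis by (meson less_imp_le)
    qed (use y(1) in blast)
    with Z[OF i(1)] show ?thesis by (auto simp: D_def)
  qed
  have C: "Max C \<in> C" using fin \<open>C \<noteq> {}\<close> by simp
  have D: "Min D \<in> D" using fin \<open>D \<noteq> {}\<close> by simp
  have gap: "z \<notin> Z" if "Max C < z" "z < Min D" for z
  proof
    assume "z \<in> Z"
    then have "z \<in> C \<or> z \<in> D \<or> z = x" by (auto simp: C_def D_def)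
    moreover have "x \<notin> Z" using x by (force simp: Z_def roots_of_def sigmas)
    ultimately show False by (metis Max_ge Min_le fin not_le that \<open>z \<in> Z\<close>)
  qed
  obtain r where r: "ereal r \<in> set as" "Max C < r" "r < Min D"
    using partition_separates_roots[OF part, of "Max C" "Min D"] C D
    by (auto simp: C_def D_def Z_def)
  have xCD: "Max C < x" "x < Min D" using C D by (auto simp: C_def D_def)
  have "poly (sigma R i) r > 0" if i: "i \<in> {1..6}" for i
  proof (rule ccontr)
    assume "\<not> poly (sigma R i) r > 0"
    moreover have "poly (sigma R i) r \<noteq> 0" using gap[OF r(2,3)] Z[OF i] by blast
    ultimately have neg: "poly (sigma R i) r < 0" by simp
    have pos: "poly (sigma R i) x > 0" using x i by blast
    consider "r < x" | "r > x" using neg pos by fastforce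
    then show False
    proof cases
      case 1
      from poly_IVT_pos[OF this neg pos] obtain z where "r < z" "z < x" "poly (sigma R i) z = 0" by blast
      then show False using gap[of z] Z[OF i, of z] r xCD by auto
    next
      case 2
      from poly_IVT_neg[OF this pos neg] obtain z where "x < z" "z < r" "poly (sigma R i) z = 0" by blast
      then show False using gap[of z] Z[OF i, of z] r xCD by auto
    qed
  qed
  then have "\<forall>i\<in>{1..6}. poly_at (sigma R i) (ereal r) > 0" by (simp add: poly_at_def zero_ereal_def)
  with r(1) show "verdict R as" unfolding verdict_def by blast
qed

theorem proposition5p10:
  fixes R :: "real^6^6"
  assumes "R \<in> Sym2b"
  shows "(\<exists>result. sec_algorithm R = Some result) \<and>
         (sec_algorithm R = Some True \<longleftrightarrow> sec_pos R) \<and>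
         (\<exists>as. sturm_partition (nonzero_sigmas R) = Some as \<and>
               common_root_isolating_partition (nonzero_sigmas R) as) \<and>
         (\<forall>as. common_root_isolating_partition (nonzero_sigmas R) as \<longrightarrow>
               (verdict R as \<longleftrightarrow> sec_pos R))"
proof -
  have R: "transpose R = R" using assms by (simp add: Sym2b_def)
  obtain as where as: "sturm_partition (nonzero_sigmas R) = Some as"
    "common_root_isolating_partition (nonzero_sigmas R) as"
    using sturm_partition_correct[of "nonzero_sigmas R"] by (auto simp: nonzero_sigmas_def)
  then have "sec_algorithm R = Some (verdict R as)" by (simp add: sec_algorithm_def)
  with as verdict_correct[OF R] show ?thesis by auto
qed

end
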